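(* Let $G=G_+G_-$ be a unique factorization of a finite group $G$, and let $\xi,\eta:G_+\to G_-$ be two group homomorphisms. Put \[ G_+'=\{u\,\xi(u^{-1}) : u\in G_+\},\qquad G_+''=\{\eta(u^{-1})\,u : u\in G_+\}, \] and $F:G_+'\to G_+''$, $F(u\xi(u^{-1}))=\eta(u)u^{-1}$. Suppose that (a) both $G_+'$ and $G_+''$ are normal subgroups of $G$, and (b) $F$ is a group isomorphism. Then \[ R=\sum_{u,v\in G_+}\{u\,(\eta(v)^{u})^{-1}\}\otimes\{v\,\xi(u)\} \] is a positive quasi-triangular structure on $H(G;G_+,G_-)$. Conversely, every positive quasi-triangular structure on $H(G;G_+,G_-)$ arises in this way from some pair of group homomorphisms $\xi,\eta:G_+\to G_-$ satisfying (a) and (b).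
   Context: A unique factorization $G=G_+G_-$ of a group $G$ consists of subgroups $G_+,G_-$ such that every $g\in G$ can be written uniquely as $g=g_+g_-$ with $g_+\in G_+$, $g_-\in G_-$ (then also uniquely as $g=\bar g_-\bar g_+$ with $\bar g_-\in G_-$, $\bar g_+\in G_+$). For $u\in G_+$ and $x\in G_-$ define ${}^u x\in G_-$, $u^x\in G_+$, ${}^x u\in G_+$, $x^u\in G_-$ by $ux=({}^u x)(u^x)$ and $xu=({}^x u)(x^u)$. $H(G;G_+,G_-)$ is the complex vector space with basis $\{g\}$, $g\in G$, and Hopf algebra structure: $\{g\}\{h\}=\delta_{g_+^{\,g_-},\,h_+}\{g h_-\}$; unit $1=\sum_{u\in G_+}\{u\}$; $\Delta\{g\}=\sum_{h\in G_+}\{g_+h^{-1}({}^{h}g_-)\}\otimes\{h g_-\}$; $\varepsilon\{g\}=\delta_{g_+,e}$; $S\{g\}=\{g^{-1}\}$. A quasi-triangular structure on a Hopf algebra $H$ is an invertible $R\in H\otimes H$ with $\tau\Delta(a)=R\Delta(a)R^{-1}$ for all $a\in H$ ($\tau$ the flip), $(\Delta\otimes\mathrm{id})R=R_{13}R_{23}$, $(\mathrm{id}\otimes\Delta)R=R_{13}R_{12}$, and $(\varepsilon\otimes\mathrm{id})R=(\mathrm{id}\otimes\varepsilon)R=1$. An element of $H(G;G_+,G_-)\otimes H(G;G_+,G_-)$ is positive if it is a linear combination of the elements $\{g\}\otimes\{h\}$, $g,h\in G$, with non-negative real coefficients. *)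

theory Defs
  imports "HOL-Algebra.Algebra" Complex_Main
begin

definition unique_factorization :: "('a,'b) monoid_scheme \<Rightarrow> 'a set \<Rightarrow> 'a set \<Rightarrow> bool" where
  "unique_factorization G Gp Gm \<longleftrightarrow> subgroup Gp G \<and> subgroup Gm G \<and>
     (\<forall>g\<in>carrier G. \<exists>!p. fst p \<in> Gp \<and> snd p \<in> Gm \<and> g = fst p \<otimes>\<^bsub>G\<^esub> snd p)"

definition fplus :: "('a,'b) monoid_scheme \<Rightarrow> 'a set \<Rightarrow> 'a set \<Rightarrow> 'a \<Rightarrow> 'a" where
  "fplus G Gp Gm g = (THE a. a \<in> Gp \<and> (\<exists>b\<in>Gm. g = a \<otimes>\<^bsub>G\<^esub> b))"
definition fminus :: "('a,'b) monoid_scheme \<Rightarrow> 'a set \<Rightarrow> 'a set \<Rightarrow> 'a \<Rightarrow> 'a" where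
  "fminus G Gp Gm g = (THE b. b \<in> Gm \<and> (\<exists>a\<in>Gp. g = a \<otimes>\<^bsub>G\<^esub> b))"
definition bminus :: "('a,'b) monoid_scheme \<Rightarrow> 'a set \<Rightarrow> 'a set \<Rightarrow> 'a \<Rightarrow> 'a" where
  "bminus G Gp Gm g = (THE b. b \<in> Gm \<and> (\<exists>a\<in>Gp. g = b \<otimes>\<^bsub>G\<^esub> a))"
definition bplus :: "('a,'b) monoid_scheme \<Rightarrow> 'a set \<Rightarrow> 'a set \<Rightarrow> 'a \<Rightarrow> 'a" where
  "bplus G Gp Gm g = (THE a. a \<in> Gp \<and> (\<exists>b\<in>Gm. g = b \<otimes>\<^bsub>G\<^esub> a))"

text \<open>For u in G+, x in G-: u x = (^u x)(u^x),  x u = (^x u)(x^u).\<close>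
definition lact_pm :: "('a,'b) monoid_scheme \<Rightarrow> 'a set \<Rightarrow> 'a set \<Rightarrow> 'a \<Rightarrow> 'a \<Rightarrow> 'a" where "lact_pm G Gp Gm u x = bminus G Gp Gm (u \<otimes>\<^bsub>G\<^esub> x)"
definition ract_pm :: "('a,'b) monoid_scheme \<Rightarrow> 'a set \<Rightarrow> 'a set \<Rightarrow> 'a \<Rightarrow> 'a \<Rightarrow> 'a" where "ract_pm G Gp Gm u x = bplus G Gp Gm (u \<otimes>\<^bsub>G\<^esub> x)"
definition lact_mp :: "('a,'b) monoid_scheme \<Rightarrow> 'a set \<Rightarrow> 'a set \<Rightarrow> 'a \<Rightarrow> 'a \<Rightarrow> 'a" where "lact_mp G Gp Gm x u = fplus G Gp Gm (x \<otimes>\<^bsub>G\<^esub> u)"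
definition ract_mp :: "('a,'b) monoid_scheme \<Rightarrow> 'a set \<Rightarrow> 'a set \<Rightarrow> 'a \<Rightarrow> 'a \<Rightarrow> 'a" where "ract_mp G Gp Gm x u = fminus G Gp Gm (x \<otimes>\<^bsub>G\<^esub> u)"

text \<open>Elements of H are functions 'a => complex supported on carrier G (coefficients
 w.r.t. the basis {g}); H (x) H and H (x) H (x) H are functions on pairs/triples.\<close>

definition in_H :: "('a,'b) monoid_scheme \<Rightarrow> ('a \<Rightarrow> complex) \<Rightarrow> bool" where
  "in_H G a \<longleftrightarrow> (\<forall>g. g \<notin> carrier G \<longrightarrow> a g = 0)"
definition in_H2 :: "('a,'b) monoid_scheme \<Rightarrow> ('a \<times> 'a \<Rightarrow> complex) \<Rightarrow> bool" where
  "in_H2 G XX \<longleftrightarrow> (\<forall>p. \<not> (fst p \<in> carrier G \<and> snd p \<in> carrier G) \<longrightarrow> XX p = 0)"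

text \<open>coefficient of {k} in {g}{h} = delta(g_+^{g_-}, h_+) {g h_-}\<close>
definition mcoef :: "('a,'b) monoid_scheme \<Rightarrow> 'a set \<Rightarrow> 'a set \<Rightarrow> 'a \<Rightarrow> 'a \<Rightarrow> 'a \<Rightarrow> complex" where
  "mcoef G Gp Gm g h k = (if ract_pm G Gp Gm (fplus G Gp Gm g) (fminus G Gp Gm g) = fplus G Gp Gm h
      \<and> k = g \<otimes>\<^bsub>G\<^esub> fminus G Gp Gm h then 1 else 0)"

definition hmult where
  "hmult G Gp Gm a b = (\<lambda>k. \<Sum>g\<in>carrier G. \<Sum>h\<in>carrier G. a g * b h * mcoef G Gp Gm g h k)"

definition hunit :: "'a set \<Rightarrow> 'a \<Rightarrow> complex" where
  "hunit Gp = (\<lambda>k. if k \<in> Gp then 1 else 0)"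

text \<open>coefficient of {k1} (x) {k2} in Delta{g}\<close>
definition ccoef :: "('a,'b) monoid_scheme \<Rightarrow> 'a set \<Rightarrow> 'a set \<Rightarrow> 'a \<Rightarrow> 'a \<Rightarrow> 'a \<Rightarrow> complex" where
  "ccoef G Gp Gm g k1 k2 = (\<Sum>h\<in>Gp.
     if k1 = fplus G Gp Gm g \<otimes>\<^bsub>G\<^esub> inv\<^bsub>G\<^esub> h \<otimes>\<^bsub>G\<^esub> lact_pm G Gp Gm h (fminus G Gp Gm g)
        \<and> k2 = h \<otimes>\<^bsub>G\<^esub> fminus G Gp Gm g then 1 else 0)"

definition hcop where
  "hcop G Gp Gm a = (\<lambda>(k1,k2). \<Sum>g\<in>carrier G. a g * ccoef G Gp Gm g k1 k2)"

definition epsb :: "('a,'b) monoid_scheme \<Rightarrow> 'a set \<Rightarrow> 'a set \<Rightarrow> 'a \<Rightarrow> complex" where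
  "epsb G Gp Gm g = (if fplus G Gp Gm g = \<one>\<^bsub>G\<^esub> then 1 else 0)"

definition tmult2 where
  "tmult2 G Gp Gm XX YY = (\<lambda>(k1,k2). \<Sum>g1\<in>carrier G. \<Sum>g2\<in>carrier G. \<Sum>h1\<in>carrier G. \<Sum>h2\<in>carrier G.
      XX (g1,g2) * YY (h1,h2) * mcoef G Gp Gm g1 h1 k1 * mcoef G Gp Gm g2 h2 k2)"

definition tunit2 :: "'a set \<Rightarrow> 'a \<times> 'a \<Rightarrow> complex" where
  "tunit2 Gp = (\<lambda>(k1,k2). hunit Gp k1 * hunit Gp k2)"

definition tmult3 where
  "tmult3 G Gp Gm XX YY = (\<lambda>(k1,k2,k3). \<Sum>g1\<in>carrier G. \<Sum>g2\<in>carrier G. \<Sum>g3\<in>carrier G.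
      \<Sum>h1\<in>carrier G. \<Sum>h2\<in>carrier G. \<Sum>h3\<in>carrier G.
      XX (g1,g2,g3) * YY (h1,h2,h3) * mcoef G Gp Gm g1 h1 k1 * mcoef G Gp Gm g2 h2 k2 * mcoef G Gp Gm g3 h3 k3)"

definition flip2 :: "('a \<times> 'a \<Rightarrow> complex) \<Rightarrow> 'a \<times> 'a \<Rightarrow> complex" where
  "flip2 XX = (\<lambda>(k1,k2). XX (k2,k1))"

definition cop_id where
  "cop_id G Gp Gm XX = (\<lambda>(k1,k2,k3). \<Sum>g\<in>carrier G. \<Sum>h\<in>carrier G.
      XX (g,h) * ccoef G Gp Gm g k1 k2 * (if k3 = h then 1 else 0))"
definition id_cop where
  "id_cop G Gp Gm XX = (\<lambda>(k1,k2,k3). \<Sum>g\<in>carrier G. \<Sum>h\<in>carrier G.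
      XX (g,h) * (if k1 = g then 1 else 0) * ccoef G Gp Gm h k2 k3)"

definition leg13 :: "'a set \<Rightarrow> ('a \<times> 'a \<Rightarrow> complex) \<Rightarrow> 'a \<times> 'a \<times> 'a \<Rightarrow> complex" where
  "leg13 Gp XX = (\<lambda>(a,b,c). XX (a,c) * hunit Gp b)"
definition leg23 :: "'a set \<Rightarrow> ('a \<times> 'a \<Rightarrow> complex) \<Rightarrow> 'a \<times> 'a \<times> 'a \<Rightarrow> complex" where
  "leg23 Gp XX = (\<lambda>(a,b,c). hunit Gp a * XX (b,c))"
definition leg12 :: "'a set \<Rightarrow> ('a \<times> 'a \<Rightarrow> complex) \<Rightarrow> 'a \<times> 'a \<times> 'a \<Rightarrow> complex" where
  "leg12 Gp XX = (\<lambda>(a,b,c). XX (a,b) * hunit Gp c)"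

definition eps_id where
  "eps_id G Gp Gm XX = (\<lambda>k. \<Sum>g\<in>carrier G. \<Sum>h\<in>carrier G. epsb G Gp Gm g * XX (g,h) * (if k = h then 1 else 0))"
definition id_eps where
  "id_eps G Gp Gm XX = (\<lambda>k. \<Sum>g\<in>carrier G. \<Sum>h\<in>carrier G. XX (g,h) * epsb G Gp Gm h * (if k = g then 1 else 0))"

definition quasi_triangular :: "('a,'b) monoid_scheme \<Rightarrow> 'a set \<Rightarrow> 'a set \<Rightarrow> ('a \<times> 'a \<Rightarrow> complex) \<Rightarrow> bool" where
  "quasi_triangular G Gp Gm R \<longleftrightarrow> in_H2 G R \<and>
     (\<exists>R'. in_H2 G R' \<and> tmult2 G Gp Gm R R' = tunit2 Gp \<and> tmult2 G Gp Gm R' R = tunit2 Gp \<and>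
        (\<forall>a. in_H G a \<longrightarrow>
           flip2 (hcop G Gp Gm a) = tmult2 G Gp Gm (tmult2 G Gp Gm R (hcop G Gp Gm a)) R')) \<and>
     cop_id G Gp Gm R = tmult3 G Gp Gm (leg13 Gp R) (leg23 Gp R) \<and>
     id_cop G Gp Gm R = tmult3 G Gp Gm (leg13 Gp R) (leg12 Gp R) \<and>
     eps_id G Gp Gm R = hunit Gp \<and> id_eps G Gp Gm R = hunit Gp"

definition positive2 :: "('a \<times> 'a \<Rightarrow> complex) \<Rightarrow> bool" where
  "positive2 XX \<longleftrightarrow> (\<forall>p. Im (XX p) = 0 \<and> Re (XX p) \<ge> 0)"

definition Gp' where "Gp' G Gp xi = (\<lambda>u. u \<otimes>\<^bsub>G\<^esub> xi (inv\<^bsub>G\<^esub> u)) ` Gp"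
definition Gp'' where "Gp'' G Gp eta = (\<lambda>u. eta (inv\<^bsub>G\<^esub> u) \<otimes>\<^bsub>G\<^esub> u) ` Gp"

definition admissible_pair where
  "admissible_pair G Gp Gm xi eta \<longleftrightarrow>
     xi \<in> hom (G\<lparr>carrier := Gp\<rparr>) (G\<lparr>carrier := Gm\<rparr>) \<and>
     eta \<in> hom (G\<lparr>carrier := Gp\<rparr>) (G\<lparr>carrier := Gm\<rparr>) \<and>
     Gp' G Gp xi \<lhd> G \<and> Gp'' G Gp eta \<lhd> G \<and>
     (\<exists>F. (\<forall>u\<in>Gp. F (u \<otimes>\<^bsub>G\<^esub> xi (inv\<^bsub>G\<^esub> u)) = eta u \<otimes>\<^bsub>G\<^esub> inv\<^bsub>G\<^esub> u) \<and>
          F \<in> iso (G\<lparr>carrier := Gp' G Gp xi\<rparr>) (G\<lparr>carrier := Gp'' G Gp eta\<rparr>))"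

definition R_xe :: "('a,'b) monoid_scheme \<Rightarrow> 'a set \<Rightarrow> 'a set \<Rightarrow> ('a \<Rightarrow> 'a) \<Rightarrow> ('a \<Rightarrow> 'a) \<Rightarrow> 'a \<times> 'a \<Rightarrow> complex" where
  "R_xe G Gp Gm xi eta = (\<lambda>(k1,k2). \<Sum>u\<in>Gp. \<Sum>v\<in>Gp.
      if k1 = u \<otimes>\<^bsub>G\<^esub> inv\<^bsub>G\<^esub> (ract_mp G Gp Gm (eta v) u) \<and> k2 = v \<otimes>\<^bsub>G\<^esub> xi u then 1 else 0)"

end

theory Submission
  imports Defs
begin

text \<open>
  In the basis \<open>u x\<close> with \<open>u \<in> G\<^sub>+\<close>, \<open>x \<in> G\<^sub>-\<close>, the algebra \<open>H\<close> is the convolution algebra of the action groupoid of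
  \<open>G\<^sub>-\<close> on \<open>G\<^sub>+\<close>, so \<open>R\<close> is a function on arrows of the squared groupoid. Positivity excludes
  cancellation in \<open>(\<Delta> \<otimes> id) R = R\<^sub>1\<^sub>3 R\<^sub>2\<^sub>3\<close>; together with the counit axioms and invertibility this forces
  the support of \<open>R\<close> to contain exactly one arrow with a given source \<open>(u, v)\<close>. The two coproduct
  axioms then give that arrow as \<open>(u (\<eta>(v)\<^sup>u)\<^sup>-\<^sup>1, v \<xi>(u))\<close> with \<open>\<xi>\<close>, \<open>\<eta>\<close> homomorphisms, and make the coefficients
  roots of unity, hence equal to 1.

  For \<open>R\<close> of this shape, \<open>\<tau>\<Delta>(a) = R \<Delta>(a) R\<^sup>-\<^sup>1\<close> amounts to three identities: \<open>\<xi>(u) x = (\<^sup>ux) \<xi>(u\<^sup>x)\<close>, the same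
  for \<open>\<eta>\<close>, and \<open>lm (\<eta> v) u \<otimes> rp v (\<xi> u) = v \<otimes> u\<close>. The first two say that \<open>G\<^sub>+'\<close> and \<open>G\<^sub>+''\<close> are normal, and given these
  the third says that \<open>F\<close> is multiplicative.
\<close>

subsection \<open>The matched pair of actions\<close>

locale factorized_group = group G for G (structure) +
  fixes Gp Gm :: "'a set"
  assumes finite_carrier: "finite (carrier G)"
    and factorization: "unique_factorization G Gp Gm"
begin

abbreviation "fp \<equiv> fplus G Gp Gm"
abbreviation "fm \<equiv> fminus G Gp Gm"
abbreviation "lp \<equiv> lact_pm G Gp Gm"
abbreviation "rp \<equiv> ract_pm G Gp Gm"
abbreviation "lm \<equiv> lact_mp G Gp Gm"
abbreviation "rm \<equiv> ract_mp G Gp Gm"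

lemma subgroup_Gp: "subgroup Gp G" and subgroup_Gm: "subgroup Gm G"
  using factorization by (auto simp: unique_factorization_def)

lemma Gp_carrier [simp, intro]: "u \<in> Gp \<Longrightarrow> u \<in> carrier G"
  and Gm_carrier [simp, intro]: "x \<in> Gm \<Longrightarrow> x \<in> carrier G"
  using subgroup.subset[OF subgroup_Gp] subgroup.subset[OF subgroup_Gm] by blast+

lemma Gp_closed [simp, intro]: "u \<in> Gp \<Longrightarrow> v \<in> Gp \<Longrightarrow> u \<otimes> v \<in> Gp" "u \<in> Gp \<Longrightarrow> inv u \<in> Gp" "\<one> \<in> Gp"
  using subgroup_Gp by (simp_all add: subgroup.m_closed subgroup.m_inv_closed subgroup.one_closed)

lemma Gm_closed [simp, intro]: "x \<in> Gm \<Longrightarrow> y \<in> Gm \<Longrightarrow> x \<otimes> y \<in> Gm" "x \<in> Gm \<Longrightarrow> inv x \<in> Gm" "\<one> \<in> Gm"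
  using subgroup_Gm by (simp_all add: subgroup.m_closed subgroup.m_inv_closed subgroup.one_closed)

lemma finite_Gp [simp, intro]: "finite Gp" and finite_Gm [simp, intro]: "finite Gm"
  using finite_carrier subgroup.subset[OF subgroup_Gp] subgroup.subset[OF subgroup_Gm] finite_subset by blast+

lemma factor_unique:
  assumes "a \<in> Gp" "a' \<in> Gp" "b \<in> Gm" "b' \<in> Gm" "a \<otimes> b = a' \<otimes> b'"
  shows "a = a'" "b = b'"
proof -
  let ?P = "\<lambda>p. fst p \<in> Gp \<and> snd p \<in> Gm \<and> a \<otimes> b = fst p \<otimes> snd p"
  have "\<exists>!p. ?P p"
    using factorization assms(1,3) by (simp add: unique_factorization_def)
  moreover have "?P (a, b)" "?P (a', b')"
    using assms by simp_all
  ultimately have "(a, b) = (a', b')"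
    by (metis (no_types))
  then show "a = a'" "b = b'" by simp_all
qed

text \<open>Inversion reverses the order of the factors and preserves both subgroups, so uniqueness
  in one order gives it in the other.\<close>

lemma factor_unique_rev:
  assumes "a \<in> Gp" "a' \<in> Gp" "b \<in> Gm" "b' \<in> Gm" "b \<otimes> a = b' \<otimes> a'"
  shows "a = a'" "b = b'"
proof -
  have "inv a \<otimes> inv b = inv a' \<otimes> inv b'"
    using assms by (simp flip: inv_mult_group)
  then have "inv a = inv a'" "inv b = inv b'"
    using factor_unique[of "inv a" "inv a'" "inv b" "inv b'"] assms(1-4) by simp_all
  then show "a = a'" "b = b'" using assms(1-4) by (simp_all add: inv_inj[THEN inj_on_eq_iff])
qed

lemma factor_eq_iff [simp]:
  "\<lbrakk>a \<in> Gp; a' \<in> Gp; b \<in> Gm; b' \<in> Gm\<rbrakk> \<Longrightarrow> a \<otimes> b = a' \<otimes> b' \<longleftrightarrow> a = a' \<and> b = b'"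
  using factor_unique[of a a' b b'] by metis

lemma factor_obtain:
  assumes "g \<in> carrier G"
  obtains u x where "u \<in> Gp" "x \<in> Gm" "g = u \<otimes> x"
proof -
  from factorization assms obtain p where "fst p \<in> Gp" "snd p \<in> Gm" "g = fst p \<otimes> snd p"
    unfolding unique_factorization_def by (auto elim!: ballE)
  then show thesis by (rule that)
qed

lemma factor_obtain_rev:
  assumes "g \<in> carrier G"
  obtains u x where "u \<in> Gp" "x \<in> Gm" "g = x \<otimes> u"
proof -
  obtain u x where *: "u \<in> Gp" "x \<in> Gm" "inv g = u \<otimes> x"
    using factor_obtain[of "inv g"] assms by auto
  have "g = inv (u \<otimes> x)" using * assms by (simp flip: *(3))
  also have "\<dots> = inv x \<otimes> inv u" using * by (simp add: inv_mult_group)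
  finally show thesis using that[of "inv u" "inv x"] * by auto
qed

lemma fp_mult [simp]: "u \<in> Gp \<Longrightarrow> x \<in> Gm \<Longrightarrow> fp (u \<otimes> x) = u"
  and fm_mult [simp]: "u \<in> Gp \<Longrightarrow> x \<in> Gm \<Longrightarrow> fm (u \<otimes> x) = x"
  unfolding fplus_def fminus_def by (rule the_equality, auto)+

lemma bplus_mult: "u \<in> Gp \<Longrightarrow> x \<in> Gm \<Longrightarrow> bplus G Gp Gm (x \<otimes> u) = u"
  and bminus_mult: "u \<in> Gp \<Longrightarrow> x \<in> Gm \<Longrightarrow> bminus G Gp Gm (x \<otimes> u) = x"
  unfolding bplus_def bminus_def by (rule the_equality, auto dest: factor_unique_rev)+

lemma fp_Gp [simp]: "u \<in> Gp \<Longrightarrow> fp u = u" and fm_Gp [simp]: "u \<in> Gp \<Longrightarrow> fm u = \<one>"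
  using fp_mult[of u \<one>] fm_mult[of u \<one>] by auto

lemma fp_Gm [simp]: "x \<in> Gm \<Longrightarrow> fp x = \<one>" and fm_Gm [simp]: "x \<in> Gm \<Longrightarrow> fm x = x"
  using fp_mult[of \<one> x] fm_mult[of \<one> x] by auto

text \<open>By uniqueness, any factorization in the opposite order that can be exhibited is the one
  defining the actions; they are always computed this way.\<close>

lemma pm_eqI:
  assumes "u \<otimes> x = y \<otimes> w" "y \<in> Gm" "w \<in> Gp"
  shows "lp u x = y" "rp u x = w"
  using assms by (auto simp: lact_pm_def ract_pm_def bplus_mult bminus_mult)

lemma mp_eqI:
  assumes "x \<otimes> u = w \<otimes> y" "y \<in> Gm" "w \<in> Gp"
  shows "lm x u = w" "rm x u = y"
  using assms by (auto simp: lact_mp_def ract_mp_def)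

lemma pm_prod:
  assumes "u \<in> Gp" "x \<in> Gm"
  shows "u \<otimes> x = lp u x \<otimes> rp u x" and lp_closed [simp]: "lp u x \<in> Gm" and rp_closed [simp]: "rp u x \<in> Gp"
proof -
  obtain w y where *: "w \<in> Gp" "y \<in> Gm" "u \<otimes> x = y \<otimes> w"
    using factor_obtain_rev[of "u \<otimes> x"] assms by auto
  then show "u \<otimes> x = lp u x \<otimes> rp u x" "lp u x \<in> Gm" "rp u x \<in> Gp"
    using pm_eqI[OF *(3,2,1)] by auto
qed

lemma mp_prod:
  assumes "x \<in> Gm" "u \<in> Gp"
  shows "x \<otimes> u = lm x u \<otimes> rm x u" and rm_closed [simp]: "rm x u \<in> Gm" and lm_closed [simp]: "lm x u \<in> Gp"
proof -
  obtain w y where *: "w \<in> Gp" "y \<in> Gm" "x \<otimes> u = w \<otimes> y"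
    using factor_obtain[of "x \<otimes> u"] assms by auto
  then show "x \<otimes> u = lm x u \<otimes> rm x u" "rm x u \<in> Gm" "lm x u \<in> Gp"
    using mp_eqI[OF *(3,2,1)] by auto
qed

lemma act_one [simp]:
  "u \<in> Gp \<Longrightarrow> lp u \<one> = \<one>" "u \<in> Gp \<Longrightarrow> rp u \<one> = u" "x \<in> Gm \<Longrightarrow> lp \<one> x = x" "x \<in> Gm \<Longrightarrow> rp \<one> x = \<one>"
  "u \<in> Gp \<Longrightarrow> rm \<one> u = \<one>" "u \<in> Gp \<Longrightarrow> lm \<one> u = u" "x \<in> Gm \<Longrightarrow> rm x \<one> = x" "x \<in> Gm \<Longrightarrow> lm x \<one> = \<one>"
  using bplus_mult[of u \<one>] bminus_mult[of u \<one>] bplus_mult[of \<one> x] bminus_mult[of \<one> x]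
  by (simp_all add: lact_pm_def ract_pm_def lact_mp_def ract_mp_def)

lemma rp_mult: assumes "u \<in> Gp" "x \<in> Gm" "y \<in> Gm" shows "rp u (x \<otimes> y) = rp (rp u x) y"
proof (rule pm_eqI)
  have "u \<otimes> (x \<otimes> y) = lp u x \<otimes> (rp u x \<otimes> y)"
    using assms by (simp add: m_assoc[symmetric] pm_prod(1)[of u x])
  then show "u \<otimes> (x \<otimes> y) = (lp u x \<otimes> lp (rp u x) y) \<otimes> rp (rp u x) y"
    using assms by (simp add: m_assoc pm_prod(1)[of "rp u x" y])
qed (use assms in auto)

lemma lp_mult: assumes "u \<in> Gp" "v \<in> Gp" "x \<in> Gm" shows "lp (u \<otimes> v) x = lp u (lp v x)"
proof (rule pm_eqI)
  have "u \<otimes> v \<otimes> x = (u \<otimes> lp v x) \<otimes> rp v x"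
    using assms by (simp add: m_assoc pm_prod(1)[of v x])
  then show "u \<otimes> v \<otimes> x = lp u (lp v x) \<otimes> (rp u (lp v x) \<otimes> rp v x)"
    using assms by (simp add: m_assoc[symmetric] pm_prod(1)[of u "lp v x"])
qed (use assms in auto)

lemma rm_mult: assumes "x \<in> Gm" "u \<in> Gp" "v \<in> Gp" shows "rm x (u \<otimes> v) = rm (rm x u) v"
proof (rule mp_eqI)
  have "x \<otimes> (u \<otimes> v) = lm x u \<otimes> (rm x u \<otimes> v)"
    using assms by (simp add: m_assoc[symmetric] mp_prod(1)[of x u])
  then show "x \<otimes> (u \<otimes> v) = (lm x u \<otimes> lm (rm x u) v) \<otimes> rm (rm x u) v"
    using assms by (simp add: m_assoc mp_prod(1)[of "rm x u" v])
qed (use assms in auto)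

text \<open>Move \<open>u\<close> to the left past \<open>y\<close> and then past \<open>x\<close>.
  The second half is the cocycle rule of a matched pair.\<close>

lemma mult_lm_rm:
  assumes "x \<in> Gm" "y \<in> Gm" "u \<in> Gp"
  shows lm_mult: "lm (x \<otimes> y) u = lm x (lm y u)"
    and rm_mult_left: "rm (x \<otimes> y) u = rm x (lm y u) \<otimes> rm y u"
proof -
  have "x \<otimes> y \<otimes> u = (x \<otimes> lm y u) \<otimes> rm y u"
    using assms by (simp add: m_assoc mp_prod(1)[of y u])
  then have *: "x \<otimes> y \<otimes> u = lm x (lm y u) \<otimes> (rm x (lm y u) \<otimes> rm y u)"
    using assms by (simp add: m_assoc[symmetric] mp_prod(1)[of x "lm y u"])
  show "lm (x \<otimes> y) u = lm x (lm y u)" "rm (x \<otimes> y) u = rm x (lm y u) \<otimes> rm y u"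
    using mp_eqI[OF *] assms by auto
qed

lemma inv_cancel [simp]:
  assumes "a \<in> carrier G" "b \<in> carrier G"
  shows "a \<otimes> (inv a \<otimes> b) = b" "inv a \<otimes> (a \<otimes> b) = b"
  using assms by (simp_all flip: m_assoc)

lemma solve_cross:
  assumes [simp]: "a \<in> carrier G" "b \<in> carrier G" "c \<in> carrier G" "d \<in> carrier G"
  shows "a \<otimes> b = c \<otimes> d \<longleftrightarrow> inv c \<otimes> a = d \<otimes> inv b"
    and "a \<otimes> b = c \<otimes> d \<longleftrightarrow> b \<otimes> inv d = inv a \<otimes> c"
proof -
  have "a \<otimes> b = c \<otimes> d \<longleftrightarrow> inv c \<otimes> (a \<otimes> b) \<otimes> inv b = inv c \<otimes> (c \<otimes> d) \<otimes> inv b"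
    by (simp del: inv_cancel)
  then show "a \<otimes> b = c \<otimes> d \<longleftrightarrow> inv c \<otimes> a = d \<otimes> inv b"
    by (simp add: m_assoc)
  have "a \<otimes> b = c \<otimes> d \<longleftrightarrow> inv a \<otimes> (a \<otimes> b) \<otimes> inv d = inv a \<otimes> (c \<otimes> d) \<otimes> inv d"
    by (simp del: inv_cancel)
  then show "a \<otimes> b = c \<otimes> d \<longleftrightarrow> b \<otimes> inv d = inv a \<otimes> c"
    by (simp add: m_assoc)
qed

text \<open>All four come from the square \<open>z \<otimes> u = lm z u \<otimes> rm z u\<close>,
  read with both \<open>Gm\<close> sides inverted or from right to left. They evaluate the actions
  on the label \<open>inv (rm z u)\<close> that occurs in the first leg of
  \<open>R_xe\<close>.\<close>

lemma mp_to_pm: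
  assumes "z \<in> Gm" "u \<in> Gp"
  shows "lp u (inv (rm z u)) = inv z" "rp u (inv (rm z u)) = lm z u"
    and "lp (lm z u) (rm z u) = z" "rp (lm z u) (rm z u) = u"
proof -
  have "u \<otimes> inv (rm z u) = inv z \<otimes> lm z u"
    using mp_prod(1)[OF assms] solve_cross(2)[of z u "lm z u" "rm z u"] assms by simp
  from pm_eqI[OF this] assms show "lp u (inv (rm z u)) = inv z" "rp u (inv (rm z u)) = lm z u" by auto
  from pm_eqI[OF mp_prod(1)[OF assms, symmetric]] assms
  show "lp (lm z u) (rm z u) = z" "rp (lm z u) (rm z u) = u" by auto
qed

lemma lm_inv:
  assumes "z \<in> Gm" "u \<in> Gp"
  shows "lm (inv z) (inv u) = inv (rp u z)"
proof (rule mp_eqI)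
  have "inv z \<otimes> inv u = inv (u \<otimes> z)" using assms by (simp add: inv_mult_group)
  also have "\<dots> = inv (rp u z) \<otimes> inv (lp u z)" using assms by (simp add: pm_prod(1) inv_mult_group)
  finally show "inv z \<otimes> inv u = inv (rp u z) \<otimes> inv (lp u z)" .
qed (use assms in auto)

lemma bij_rp: assumes "z \<in> Gm" shows "bij_betw (\<lambda>u. rp u z) Gp Gp"
  by (rule bij_betw_byWitness[where f' = "\<lambda>u. rp u (inv z)"])
     (use assms in \<open>auto simp: rp_mult[symmetric]\<close>)

lemma bij_lm: assumes "z \<in> Gm" shows "bij_betw (\<lambda>u. lm z u) Gp Gp"
  by (rule bij_betw_byWitness[where f' = "\<lambda>u. lm (inv z) u"])
     (use assms in \<open>auto simp: lm_mult[symmetric]\<close>)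

lemma inj_lp: assumes "u \<in> Gp" "x \<in> Gm" "y \<in> Gm" "lp u x = lp u y" shows "x = y"
  using assms lp_mult[of "inv u" u x] lp_mult[of "inv u" u y] by simp

lemma sum_carrier: "(\<Sum>g\<in>carrier G. f g) = (\<Sum>u\<in>Gp. \<Sum>x\<in>Gm. f (u \<otimes> x))"
proof -
  have "bij_betw (\<lambda>(u,x). u \<otimes> x) (Gp \<times> Gm) (carrier G)"
    unfolding bij_betw_def inj_on_def by (auto elim!: factor_obtain)
  from sum.reindex_bij_betw[OF this, of f, symmetric]
  show ?thesis by (simp add: sum.cartesian_product case_prod_unfold)
qed

text \<open>The basis element \<open>u \<otimes> x\<close> is an arrow from \<open>u\<close> to
  \<open>rp u x\<close>; products of non-composable arrows vanish. The conditions are nested, one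
  equation each, so that sums over coordinates collapse one variable at a time.\<close>

lemma mcoef_eq:
  assumes "u \<in> Gp" "x \<in> Gm" "v \<in> Gp" "y \<in> Gm" "w \<in> Gp" "z \<in> Gm"
  shows "mcoef G Gp Gm (u \<otimes> x) (v \<otimes> y) (w \<otimes> z) = (if u = w then if v = rp u x then if y = inv x \<otimes> z then 1 else 0 else 0 else 0)"
proof -
  have "w \<otimes> z = u \<otimes> x \<otimes> y \<longleftrightarrow> u = w \<and> y = inv x \<otimes> z"
    using assms by (auto simp: m_assoc)
  then show ?thesis using assms by (auto simp: mcoef_def)
qed

lemma mcoef_outside: "\<lbrakk>g \<in> carrier G; h \<in> carrier G; k \<notin> carrier G\<rbrakk> \<Longrightarrow> mcoef G Gp Gm g h k = 0"
  by (auto simp: mcoef_def elim!: factor_obtain)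

text \<open>The second leg of the summand has \<open>Gp\<close> component \<open>h\<close>, so only
  \<open>h = w\<close> can contribute.\<close>

lemma ccoef_eq:
  assumes "u \<in> Gp" "x \<in> Gm" "v \<in> Gp" "y \<in> Gm" "w \<in> Gp" "z \<in> Gm"
  shows "ccoef G Gp Gm (u \<otimes> x) (v \<otimes> y) (w \<otimes> z) = (if u = v \<otimes> w then if x = z then if y = lp w z then 1 else 0 else 0 else 0)"
proof -
  have *: "(v \<otimes> y = u \<otimes> inv h \<otimes> lp h x \<and> w \<otimes> z = h \<otimes> x) \<longleftrightarrow> w = h \<and> u = v \<otimes> w \<and> x = z \<and> y = lp w z" if "h \<in> Gp" for h
  proof -
    have "v \<otimes> y = u \<otimes> inv h \<otimes> lp h x \<longleftrightarrow> v = u \<otimes> inv h \<and> y = lp h x"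
      using assms that factor_eq_iff[of v "u \<otimes> inv h" y "lp h x"] by simp
    moreover have "v = u \<otimes> inv h \<longleftrightarrow> u = v \<otimes> h"
      using assms that by (auto simp: m_assoc)
    ultimately show ?thesis using assms that by auto
  qed
  have "ccoef G Gp Gm (u \<otimes> x) (v \<otimes> y) (w \<otimes> z)
      = (\<Sum>h\<in>Gp. if w = h then if u = v \<otimes> w \<and> x = z \<and> y = lp w z then 1 else 0 else 0)"
    using assms(1,2) unfolding ccoef_def by (intro sum.cong) (auto simp only: fp_mult fm_mult * split: if_splits)
  then show ?thesis using assms by simp
qed

lemma ccoef_outside: "\<lbrakk>g \<in> carrier G; k \<notin> carrier G \<or> l \<notin> carrier G\<rbrakk> \<Longrightarrow> ccoef G Gp Gm g k l = 0"
  by (auto simp: ccoef_def elim!: factor_obtain intro!: sum.neutral)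

lemma hunit_eq [simp]: "u \<in> Gp \<Longrightarrow> x \<in> Gm \<Longrightarrow> hunit Gp (u \<otimes> x) = (if x = \<one> then 1 else 0)"
proof -
  assume *: "u \<in> Gp" "x \<in> Gm"
  have "u \<otimes> x \<in> Gp \<longleftrightarrow> x = \<one>"
    using * factor_unique(2)[of "u \<otimes> x" u \<one> x] by auto
  then show ?thesis by (simp add: hunit_def)
qed

lemma hunit_outside: "k \<notin> carrier G \<Longrightarrow> hunit Gp k = 0"
  by (auto simp: hunit_def)

subsection \<open>Structure maps in coordinates\<close>

lemma mult_if_zero:
  fixes x y :: "'c::mult_zero"
  shows "x * (if P then y else 0) = (if P then x * y else 0)" "(if P then y else 0) * x = (if P then y * x else 0)"
  by simp_all

lemma sum_if_const: "(\<Sum>a\<in>A. if P then f a else 0) = (if P then \<Sum>a\<in>A. f a else 0)"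
  by simp

text \<open>In a groupoid the first arrow and the composite determine the second arrow, so at most
  one term survives.\<close>

lemma sum_mcoef:
  assumes "u \<in> Gp" "x \<in> Gm" "w \<in> Gp" "z \<in> Gm"
  shows "(\<Sum>h\<in>carrier G. A h * mcoef G Gp Gm (u \<otimes> x) h (w \<otimes> z))
    = (if u = w then A (rp u x \<otimes> (inv x \<otimes> z)) else 0)"
proof -
  have "(\<Sum>h\<in>carrier G. A h * mcoef G Gp Gm (u \<otimes> x) h (w \<otimes> z))
    = (\<Sum>v\<in>Gp. \<Sum>y\<in>Gm. if v = rp u x then if y = inv x \<otimes> z then if u = w then A (v \<otimes> y) else 0 else 0 else 0)"
    unfolding sum_carrier using assms by (intro sum.cong) (auto simp: mcoef_eq)
  also have "\<dots> = (if u = w then A (rp u x \<otimes> (inv x \<otimes> z)) else 0)"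
    unfolding sum_if_const using assms by simp
  finally show ?thesis .
qed

lemma tmult2_eq:
  assumes "u1 \<in> Gp" "x1 \<in> Gm" "u2 \<in> Gp" "x2 \<in> Gm"
  shows "tmult2 G Gp Gm XX YY (u1 \<otimes> x1, u2 \<otimes> x2) = (\<Sum>a\<in>Gm. \<Sum>b\<in>Gm.
    XX (u1 \<otimes> a, u2 \<otimes> b) * YY (rp u1 a \<otimes> (inv a \<otimes> x1), rp u2 b \<otimes> (inv b \<otimes> x2)))"
proof -
  have *: "(\<Sum>h1\<in>carrier G. \<Sum>h2\<in>carrier G. XX (v \<otimes> a, w \<otimes> b) * YY (h1, h2)
        * mcoef G Gp Gm (v \<otimes> a) h1 (u1 \<otimes> x1) * mcoef G Gp Gm (w \<otimes> b) h2 (u2 \<otimes> x2))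
      = (if v = u1 then if w = u2 then XX (v \<otimes> a, w \<otimes> b) * YY (rp v a \<otimes> (inv a \<otimes> x1), rp w b \<otimes> (inv b \<otimes> x2)) else 0 else 0)"
    if "v \<in> Gp" "w \<in> Gp" "a \<in> Gm" "b \<in> Gm" for v w a b
    using that assms by (simp add: sum_mcoef)
  have "tmult2 G Gp Gm XX YY (u1 \<otimes> x1, u2 \<otimes> x2) = (\<Sum>v\<in>Gp. \<Sum>a\<in>Gm. \<Sum>w\<in>Gp. \<Sum>b\<in>Gm.
      if v = u1 then if w = u2 then XX (v \<otimes> a, w \<otimes> b) * YY (rp v a \<otimes> (inv a \<otimes> x1), rp w b \<otimes> (inv b \<otimes> x2)) else 0 else 0)"
    unfolding tmult2_def case_prod_conv
    by (subst sum_carrier, rule sum.cong[OF refl], rule sum.cong[OF refl],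
        subst sum_carrier, rule sum.cong[OF refl], rule sum.cong[OF refl], rule *)
  then show ?thesis
    unfolding sum_if_const using assms by simp
qed

lemma tmult3_eq:
  assumes "u1 \<in> Gp" "x1 \<in> Gm" "u2 \<in> Gp" "x2 \<in> Gm" "u3 \<in> Gp" "x3 \<in> Gm"
  shows "tmult3 G Gp Gm XX YY (u1 \<otimes> x1, u2 \<otimes> x2, u3 \<otimes> x3) = (\<Sum>a\<in>Gm. \<Sum>b\<in>Gm. \<Sum>c\<in>Gm.
    XX (u1 \<otimes> a, u2 \<otimes> b, u3 \<otimes> c) *
      YY (rp u1 a \<otimes> (inv a \<otimes> x1), rp u2 b \<otimes> (inv b \<otimes> x2), rp u3 c \<otimes> (inv c \<otimes> x3)))"
proof -
  have *: "(\<Sum>h1\<in>carrier G. \<Sum>h2\<in>carrier G. \<Sum>h3\<in>carrier G. XX (v \<otimes> a, w \<otimes> b, t \<otimes> c) * YY (h1, h2, h3)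
        * mcoef G Gp Gm (v \<otimes> a) h1 (u1 \<otimes> x1) * mcoef G Gp Gm (w \<otimes> b) h2 (u2 \<otimes> x2)
        * mcoef G Gp Gm (t \<otimes> c) h3 (u3 \<otimes> x3))
      = (if v = u1 then if w = u2 then if t = u3 then XX (v \<otimes> a, w \<otimes> b, t \<otimes> c) *
          YY (rp v a \<otimes> (inv a \<otimes> x1), rp w b \<otimes> (inv b \<otimes> x2), rp t c \<otimes> (inv c \<otimes> x3)) else 0 else 0 else 0)"
    if "v \<in> Gp" "w \<in> Gp" "t \<in> Gp" "a \<in> Gm" "b \<in> Gm" "c \<in> Gm" for v w t a b c
    using that assms by (simp add: sum_mcoef)
  have "tmult3 G Gp Gm XX YY (u1 \<otimes> x1, u2 \<otimes> x2, u3 \<otimes> x3) =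
      (\<Sum>v\<in>Gp. \<Sum>a\<in>Gm. \<Sum>w\<in>Gp. \<Sum>b\<in>Gm. \<Sum>t\<in>Gp. \<Sum>c\<in>Gm.
        if v = u1 then if w = u2 then if t = u3 then XX (v \<otimes> a, w \<otimes> b, t \<otimes> c) *
          YY (rp v a \<otimes> (inv a \<otimes> x1), rp w b \<otimes> (inv b \<otimes> x2), rp t c \<otimes> (inv c \<otimes> x3)) else 0 else 0 else 0)"
    unfolding tmult3_def case_prod_conv
    by (subst sum_carrier, rule sum.cong[OF refl], rule sum.cong[OF refl],
        subst sum_carrier, rule sum.cong[OF refl], rule sum.cong[OF refl],
        subst sum_carrier, rule sum.cong[OF refl], rule sum.cong[OF refl], rule *)
  then show ?thesis
    unfolding sum_if_const using assms by simp
qed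

lemma tmult2_outside: "\<not> (k1 \<in> carrier G \<and> k2 \<in> carrier G) \<Longrightarrow> tmult2 G Gp Gm XX YY (k1, k2) = 0"
  by (auto simp: tmult2_def mcoef_outside intro!: sum.neutral)

lemma tmult3_outside:
  "\<not> (k1 \<in> carrier G \<and> k2 \<in> carrier G \<and> k3 \<in> carrier G) \<Longrightarrow> tmult3 G Gp Gm XX YY (k1, k2, k3) = 0"
  by (auto simp: tmult3_def mcoef_outside intro!: sum.neutral)

lemma hcop_eq:
  assumes "u1 \<in> Gp" "x1 \<in> Gm" "u2 \<in> Gp" "x2 \<in> Gm"
  shows "hcop G Gp Gm \<alpha> (u1 \<otimes> x1, u2 \<otimes> x2) = (if x1 = lp u2 x2 then \<alpha> (u1 \<otimes> u2 \<otimes> x2) else 0)"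
proof -
  have "hcop G Gp Gm \<alpha> (u1 \<otimes> x1, u2 \<otimes> x2) = (\<Sum>u\<in>Gp. \<Sum>x\<in>Gm.
      if u = u1 \<otimes> u2 then if x = x2 then if x1 = lp u2 x2 then \<alpha> (u \<otimes> x) else 0 else 0 else 0)"
    unfolding hcop_def case_prod_conv sum_carrier using assms
    by (intro sum.cong) (auto simp: ccoef_eq)
  then show ?thesis unfolding sum_if_const using assms by simp
qed

lemma hcop_outside: "\<not> (k1 \<in> carrier G \<and> k2 \<in> carrier G) \<Longrightarrow> hcop G Gp Gm \<alpha> (k1, k2) = 0"
  by (auto simp: hcop_def ccoef_outside intro!: sum.neutral)

text \<open>The last leg is a parameter: fix it and apply the formula for the coproduct to the slice
  of \<open>XX\<close>.\<close>

lemma cop_id_eq: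
  assumes "u1 \<in> Gp" "x1 \<in> Gm" "u2 \<in> Gp" "x2 \<in> Gm" "k \<in> carrier G"
  shows "cop_id G Gp Gm XX (u1 \<otimes> x1, u2 \<otimes> x2, k) = (if x1 = lp u2 x2 then XX (u1 \<otimes> u2 \<otimes> x2, k) else 0)"
proof -
  have "cop_id G Gp Gm XX (u1 \<otimes> x1, u2 \<otimes> x2, k) = hcop G Gp Gm (\<lambda>g. XX (g, k)) (u1 \<otimes> x1, u2 \<otimes> x2)"
    unfolding cop_id_def hcop_def case_prod_conv
    using assms finite_carrier by (intro sum.cong refl) (simp add: mult_if_zero)
  then show ?thesis using assms by (simp add: hcop_eq)
qed

lemma id_cop_eq:
  assumes "u1 \<in> Gp" "x1 \<in> Gm" "u2 \<in> Gp" "x2 \<in> Gm" "k \<in> carrier G"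
  shows "id_cop G Gp Gm XX (k, u1 \<otimes> x1, u2 \<otimes> x2) = (if x1 = lp u2 x2 then XX (k, u1 \<otimes> u2 \<otimes> x2) else 0)"
proof -
  have "id_cop G Gp Gm XX (k, u1 \<otimes> x1, u2 \<otimes> x2) = hcop G Gp Gm (\<lambda>g. XX (k, g)) (u1 \<otimes> x1, u2 \<otimes> x2)"
    unfolding id_cop_def hcop_def case_prod_conv
    using assms finite_carrier by (subst sum.swap, intro sum.cong refl) (simp add: mult_if_zero)
  then show ?thesis using assms by (simp add: hcop_eq)
qed

lemma cop_outside:
  assumes "\<not> (k1 \<in> carrier G \<and> k2 \<in> carrier G \<and> k3 \<in> carrier G)"
  shows "cop_id G Gp Gm XX (k1, k2, k3) = 0" "id_cop G Gp Gm XX (k1, k2, k3) = 0"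
  using assms by (auto simp: cop_id_def id_cop_def ccoef_outside intro!: sum.neutral)

text \<open>The \<open>hunit\<close> legs contain identity arrows only. This forces
  \<open>b = \<one>\<close> and \<open>a = x1\<close> in the triple sum, leaving the sum over the
  third leg.\<close>

lemma tmult3_13_23:
  assumes "u1 \<in> Gp" "x1 \<in> Gm" "u2 \<in> Gp" "x2 \<in> Gm" "u3 \<in> Gp" "x3 \<in> Gm"
  shows "tmult3 G Gp Gm (leg13 Gp XX) (leg23 Gp XX) (u1 \<otimes> x1, u2 \<otimes> x2, u3 \<otimes> x3)
    = (\<Sum>a\<in>Gm. XX (u1 \<otimes> x1, u3 \<otimes> a) * XX (u2 \<otimes> x2, rp u3 a \<otimes> (inv a \<otimes> x3)))"
proof -
  have *: "inv a \<otimes> x1 = \<one> \<longleftrightarrow> a = x1" if "a \<in> Gm" for a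
    using assms that by (metis Gm_carrier inv_closed inv_inv inv_unique' l_inv r_one inv_equality)
  have "tmult3 G Gp Gm (leg13 Gp XX) (leg23 Gp XX) (u1 \<otimes> x1, u2 \<otimes> x2, u3 \<otimes> x3)
    = (\<Sum>a\<in>Gm. \<Sum>b\<in>Gm. \<Sum>c\<in>Gm. if a = x1 then if b = \<one> then
       XX (u1 \<otimes> x1, u3 \<otimes> c) * XX (u2 \<otimes> x2, rp u3 c \<otimes> (inv c \<otimes> x3)) else 0 else 0)"
    using assms unfolding tmult3_eq[OF assms] by (intro sum.cong refl) (auto simp: leg13_def leg23_def *)
  then show ?thesis unfolding sum_if_const using assms by simp
qed

lemma tmult3_13_12:
  assumes "u1 \<in> Gp" "x1 \<in> Gm" "u2 \<in> Gp" "x2 \<in> Gm" "u3 \<in> Gp" "x3 \<in> Gm"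
  shows "tmult3 G Gp Gm (leg13 Gp XX) (leg12 Gp XX) (u1 \<otimes> x1, u2 \<otimes> x2, u3 \<otimes> x3)
    = (\<Sum>a\<in>Gm. XX (u1 \<otimes> a, u3 \<otimes> x3) * XX (rp u1 a \<otimes> (inv a \<otimes> x1), u2 \<otimes> x2))"
proof -
  have *: "inv c \<otimes> x3 = \<one> \<longleftrightarrow> c = x3" if "c \<in> Gm" for c
    using assms that by (metis Gm_carrier inv_closed inv_inv inv_unique' l_inv r_one inv_equality)
  have "tmult3 G Gp Gm (leg13 Gp XX) (leg12 Gp XX) (u1 \<otimes> x1, u2 \<otimes> x2, u3 \<otimes> x3)
    = (\<Sum>a\<in>Gm. \<Sum>b\<in>Gm. \<Sum>c\<in>Gm. if b = \<one> then if c = x3 then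
       XX (u1 \<otimes> a, u3 \<otimes> x3) * XX (rp u1 a \<otimes> (inv a \<otimes> x1), u2 \<otimes> x2) else 0 else 0)"
    using assms unfolding tmult3_eq[OF assms] by (intro sum.cong refl) (auto simp: leg13_def leg12_def *)
  then show ?thesis unfolding sum_if_const using assms by simp
qed

lemma eps_id_eq:
  assumes "k \<in> carrier G" shows "eps_id G Gp Gm XX k = (\<Sum>x\<in>Gm. XX (x, k))"
proof -
  have "eps_id G Gp Gm XX k = (\<Sum>u\<in>Gp. \<Sum>x\<in>Gm. if u = \<one> then XX (u \<otimes> x, k) else 0)"
    unfolding eps_id_def
    by (subst sum_carrier, rule sum.cong[OF refl], rule sum.cong[OF refl])
       (use assms finite_carrier in \<open>simp add: mult_if_zero epsb_def\<close>)
  then show ?thesis unfolding sum_if_const by simp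
qed

lemma id_eps_eq:
  assumes "k \<in> carrier G" shows "id_eps G Gp Gm XX k = (\<Sum>x\<in>Gm. XX (k, x))"
proof -
  have "id_eps G Gp Gm XX k = (\<Sum>u\<in>Gp. \<Sum>x\<in>Gm. if u = \<one> then XX (k, u \<otimes> x) else 0)"
    unfolding id_eps_def
    by (subst sum.swap, subst sum_carrier)
       (use assms finite_carrier in \<open>intro sum.cong refl, simp add: mult_if_zero epsb_def\<close>)
  then show ?thesis unfolding sum_if_const by simp
qed

lemma eps_outside:
  assumes "k \<notin> carrier G"
  shows "eps_id G Gp Gm XX k = 0" "id_eps G Gp Gm XX k = 0"
  using assms by (auto simp: eps_id_def id_eps_def intro!: sum.neutral)

subsection \<open>Compatibility conditions\<close>

text \<open>Since \<open>u \<otimes> x = lp u x \<otimes> rp u x\<close>, the condition says that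
  \<open>inv x \<otimes> (inv u \<otimes> f u) \<otimes> x\<close> is the element of the same form
  at \<open>rp u x\<close>.\<close>

definition equivariant :: "('a \<Rightarrow> 'a) \<Rightarrow> bool" where
  "equivariant f \<longleftrightarrow> (\<forall>u\<in>Gp. \<forall>x\<in>Gm. f u \<otimes> x = lp u x \<otimes> f (rp u x))"

text \<open>The map sending \<open>(v, u)\<close> to
  \<open>(lm (\<eta> v) u, rp v (\<xi> u))\<close> preserves products: this is the \<open>Gp\<close>
  part of the relation with the flipped coproduct.\<close>

definition exchange :: "('a \<Rightarrow> 'a) \<Rightarrow> ('a \<Rightarrow> 'a) \<Rightarrow> bool" where
  "exchange \<xi> \<eta> \<longleftrightarrow> (\<forall>u\<in>Gp. \<forall>v\<in>Gp. lm (\<eta> v) u \<otimes> rp v (\<xi> u) = v \<otimes> u)"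

lemma equivariantD: "equivariant f \<Longrightarrow> u \<in> Gp \<Longrightarrow> x \<in> Gm \<Longrightarrow> f u \<otimes> x = lp u x \<otimes> f (rp u x)"
  by (simp add: equivariant_def)

lemma exchangeD: "exchange \<xi> \<eta> \<Longrightarrow> u \<in> Gp \<Longrightarrow> v \<in> Gp \<Longrightarrow> lm (\<eta> v) u \<otimes> rp v (\<xi> u) = v \<otimes> u"
  by (simp add: exchange_def)

lemma equivariant_left:
  assumes "equivariant f" "u \<in> Gp" "x \<in> Gm"
  shows "x \<otimes> f u = f (lm x u) \<otimes> rm x u"
  using assms by (simp add: equivariantD[of f "lm x u" "rm x u"] mp_to_pm)

section \<open>The normal subgroup of twisted elements \<open>inv u \<otimes> f u\<close>\<close>

context
  fixes f :: "'a \<Rightarrow> 'a"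
  assumes f_closed: "\<And>u. u \<in> Gp \<Longrightarrow> f u \<in> Gm"
    and f_mult: "\<And>u v. \<lbrakk>u \<in> Gp; v \<in> Gp\<rbrakk> \<Longrightarrow> f (u \<otimes> v) = f u \<otimes> f v"
    and f_equivariant: "equivariant f"
begin

lemma twist_conjugate:
  assumes "u \<in> Gp" "x \<in> Gm"
  shows "x \<otimes> (inv u \<otimes> f u) \<otimes> inv x = inv (rp u (inv x)) \<otimes> f (rp u (inv x))"
proof -
  have "f u \<otimes> inv x = lp u (inv x) \<otimes> f (rp u (inv x))"
    using equivariantD[OF f_equivariant] assms by simp
  moreover have "x \<otimes> inv u = inv (rp u (inv x)) \<otimes> inv (lp u (inv x))"
    using arg_cong[OF pm_prod(1)[of u "inv x"], of "\<lambda>g. inv g"] assms by (simp add: inv_mult_group)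
  moreover have "x \<otimes> (inv u \<otimes> f u) \<otimes> inv x = (x \<otimes> inv u) \<otimes> (f u \<otimes> inv x)"
    using assms f_closed by (simp add: m_assoc)
  ultimately show ?thesis using assms f_closed by (simp add: m_assoc)
qed

text \<open>Insert \<open>inv (f u) \<otimes> f u\<close>: the second element gets conjugated by
  \<open>f u\<close>, which lies in \<open>Gm\<close>, and multiplicativity of \<open>f\<close>
  merges what remains.\<close>

lemma twist_mult:
  assumes "u \<in> Gp" "v \<in> Gp"
  shows "(inv u \<otimes> f u) \<otimes> (inv v \<otimes> f v)
    = inv (rp v (inv (f u)) \<otimes> u) \<otimes> f (rp v (inv (f u)) \<otimes> u)"
proof -
  have "(inv u \<otimes> f u) \<otimes> (inv v \<otimes> f v) = inv u \<otimes> (f u \<otimes> (inv v \<otimes> f v) \<otimes> inv (f u)) \<otimes> f u"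
    using assms f_closed by (simp add: m_assoc)
  also have "\<dots> = inv (rp v (inv (f u)) \<otimes> u) \<otimes> f (rp v (inv (f u)) \<otimes> u)"
    unfolding twist_conjugate[OF assms(2) f_closed[OF assms(1)]]
    using assms f_closed by (simp add: f_mult inv_mult_group m_assoc)
  finally show ?thesis .
qed

text \<open>Every group element is an element of \<open>Gm\<close> times the inverse of a twisted
  element. Conjugation by the former preserves the twisted elements by
  \<open>twist_conjugate\<close>, conjugation by the latter takes place inside the subgroup.\<close>

lemma normal_twist: "(\<lambda>u. inv u \<otimes> f u) ` Gp \<lhd> G" (is "?N \<lhd> G")
proof -
  have f_one: "f \<one> = \<one>"
    using f_mult[of \<one> \<one>] f_closed[of \<one>] by simp
  have sub: "subgroup ?N G"
  proof (rule subgroupI)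
    fix n assume "n \<in> ?N"
    then obtain u where u: "u \<in> Gp" "n = inv u \<otimes> f u" by blast
    \<comment> \<open>Chosen so that the index \<open>rp v (inv (f u)) \<otimes> u\<close> given by
      \<open>twist_mult\<close> is \<open>\<one>\<close>.\<close>
    define v where "v = rp (inv u) (f u)"
    have v: "v \<in> Gp" "rp v (inv (f u)) = inv u"
      using u f_closed by (simp_all add: v_def rp_mult[symmetric])
    have "n \<otimes> (inv v \<otimes> f v) = \<one>"
      using u v twist_mult[of u v] by (simp add: f_one)
    then have "inv n = inv v \<otimes> f v"
      using u v f_closed by (intro inv_equality) (simp_all add: inv_comm)
    then show "inv n \<in> ?N" using v by blast
  next
    fix m n assume "m \<in> ?N" "n \<in> ?N"
    then show "m \<otimes> n \<in> ?N" by (auto simp: twist_mult f_closed)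
  qed (use f_closed in auto)
  have "g \<otimes> n \<otimes> inv g \<in> ?N" if g: "g \<in> carrier G" and n: "n \<in> ?N" for g n
  proof -
    obtain u x where u: "u \<in> Gp" "x \<in> Gm" "g = x \<otimes> u" using g by (rule factor_obtain_rev)
    let ?p = "inv u \<otimes> f u"
    have p: "?p \<in> ?N" "?p \<in> carrier G" using u f_closed by auto
    have nc: "n \<in> carrier G" using n f_closed by auto
    have "inv ?p \<otimes> n \<otimes> ?p \<in> ?N"
      using subgroup.m_closed[OF sub subgroup.m_closed[OF sub subgroup.m_inv_closed[OF sub p(1)] n] p(1)] .
    then obtain w where w: "w \<in> Gp" "inv ?p \<otimes> n \<otimes> ?p = inv w \<otimes> f w" by blast
    let ?y = "x \<otimes> f u"
    have "g = ?y \<otimes> inv ?p" using u f_closed by (simp add: m_assoc inv_mult_group)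
    then have "g \<otimes> n \<otimes> inv g = ?y \<otimes> (inv ?p \<otimes> n \<otimes> ?p) \<otimes> inv ?y"
      using u p nc f_closed by (simp add: m_assoc inv_mult_group)
    also have "\<dots> \<in> ?N"
      unfolding w(2) using twist_conjugate[of w ?y] u w f_closed by auto
    finally show ?thesis .
  qed
  with sub show ?thesis by (simp add: normal_inv_iff)
qed

end

end

section \<open>Homomorphism pairs, the element \<open>R_xe\<close> and its inverse\<close>

locale hom_pair = factorized_group G Gp Gm for G (structure) and Gp Gm +
  fixes \<xi> \<eta> :: "'a \<Rightarrow> 'a"
  assumes hom_xi: "\<xi> \<in> hom (G\<lparr>carrier := Gp\<rparr>) (G\<lparr>carrier := Gm\<rparr>)"
    and hom_eta: "\<eta> \<in> hom (G\<lparr>carrier := Gp\<rparr>) (G\<lparr>carrier := Gm\<rparr>)"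
begin

lemma xi_closed [simp]: "u \<in> Gp \<Longrightarrow> \<xi> u \<in> Gm"
  and eta_closed [simp]: "u \<in> Gp \<Longrightarrow> \<eta> u \<in> Gm"
  using hom_xi hom_eta by (auto simp: hom_def)

lemma xi_mult: "u \<in> Gp \<Longrightarrow> v \<in> Gp \<Longrightarrow> \<xi> (u \<otimes> v) = \<xi> u \<otimes> \<xi> v"
  and eta_mult: "u \<in> Gp \<Longrightarrow> v \<in> Gp \<Longrightarrow> \<eta> (u \<otimes> v) = \<eta> u \<otimes> \<eta> v"
  using hom_xi hom_eta by (auto simp: hom_def)

lemma xi_one [simp]: "\<xi> \<one> = \<one>" and eta_one [simp]: "\<eta> \<one> = \<one>"
  using xi_mult[of \<one> \<one>] eta_mult[of \<one> \<one>] by (simp_all add: l_cancel_one')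

lemma xi_inv: "u \<in> Gp \<Longrightarrow> \<xi> (inv u) = inv (\<xi> u)"
  by (rule inv_equality[symmetric]) (simp_all flip: xi_mult)

lemma eta_inv: "u \<in> Gp \<Longrightarrow> \<eta> (inv u) = inv (\<eta> u)"
  by (rule inv_equality[symmetric]) (simp_all flip: eta_mult)

text \<open>Apply \<open>\<xi>\<close> to the exchange identity and expand
  \<open>\<xi> v \<otimes> \<xi> u\<close> by equivariance; the right factor
  \<open>\<xi> (rp v (\<xi> u))\<close> cancels.\<close>

lemma exchange_xi:
  assumes "equivariant \<xi>" "exchange \<xi> \<eta>" "u \<in> Gp" "v \<in> Gp"
  shows "\<xi> (lm (\<eta> v) u) = lp v (\<xi> u)"
proof -
  have "\<xi> (lm (\<eta> v) u) \<otimes> \<xi> (rp v (\<xi> u)) = lp v (\<xi> u) \<otimes> \<xi> (rp v (\<xi> u))"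
    using assms xi_mult[of "lm (\<eta> v) u" "rp v (\<xi> u)"] equivariantD[of \<xi> v "\<xi> u"]
    by (simp add: exchangeD xi_mult)
  then show ?thesis using assms by simp
qed

text \<open>The mirror argument: by \<open>equivariant_left\<close>, the factor
  \<open>\<eta> (lm (\<eta> v) u)\<close> cancels on the left.\<close>

lemma exchange_eta:
  assumes "equivariant \<eta>" "exchange \<xi> \<eta>" "u \<in> Gp" "v \<in> Gp"
  shows "rm (\<eta> v) u = \<eta> (rp v (\<xi> u))"
proof -
  have "\<eta> (lm (\<eta> v) u) \<otimes> \<eta> (rp v (\<xi> u)) = \<eta> (lm (\<eta> v) u) \<otimes> rm (\<eta> v) u"
    using assms eta_mult[of "lm (\<eta> v) u" "rp v (\<xi> u)"] equivariant_left[of \<eta> u "\<eta> v"]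
    by (simp add: exchangeD eta_mult)
  then show ?thesis using assms by simp
qed

lemma R_xe_eq:
  assumes "u \<in> Gp" "x \<in> Gm" "v \<in> Gp" "y \<in> Gm"
  shows "R_xe G Gp Gm \<xi> \<eta> (u \<otimes> x, v \<otimes> y) = (if x = inv (rm (\<eta> v) u) then if y = \<xi> u then 1 else 0 else 0)"
proof -
  have "R_xe G Gp Gm \<xi> \<eta> (u \<otimes> x, v \<otimes> y)
    = (\<Sum>u'\<in>Gp. \<Sum>v'\<in>Gp. if u = u' then if v = v' then if x = inv (rm (\<eta> v) u) then if y = \<xi> u then 1 else 0 else 0 else 0 else 0)"
    unfolding R_xe_def case_prod_conv using assms by (intro sum.cong refl) auto
  then show ?thesis unfolding sum_if_const using assms by simp
qed

lemma R_xe_outside: "\<not> (k1 \<in> carrier G \<and> k2 \<in> carrier G) \<Longrightarrow> R_xe G Gp Gm \<xi> \<eta> (k1, k2) = 0"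
  unfolding R_xe_def case_prod_conv by (intro sum.neutral ballI) auto

text \<open>The reversed arrows of \<open>R_xe\<close>. The label \<open>rm (\<eta> v) u\<close> of
  the reversed arrow is written as \<open>\<eta>\<close> of the second coordinate of its source, so
  this is the inverse once \<open>rm (\<eta> v) u = \<eta> (rp v (\<xi> u))\<close> holds.\<close>

definition Rinv :: "'a \<times> 'a \<Rightarrow> complex" where
  "Rinv = (\<lambda>(g, h). if g \<in> carrier G \<and> h \<in> carrier G then
     if fm g = \<eta> (fp h) then if fm h = inv (\<xi> (rp (fp g) (fm g))) then 1 else 0 else 0 else 0)"

lemma Rinv_eq:
  assumes "u \<in> Gp" "x \<in> Gm" "v \<in> Gp" "y \<in> Gm"
  shows "Rinv (u \<otimes> x, v \<otimes> y) = (if x = \<eta> v then if y = inv (\<xi> (rp u x)) then 1 else 0 else 0)"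
  using assms by (simp add: Rinv_def)

text \<open>\<open>R_xe\<close> contains exactly one arrow out of each source, so left
  multiplication by it only moves the argument.\<close>

lemma R_xe_left:
  assumes "u1 \<in> Gp" "x1 \<in> Gm" "u2 \<in> Gp" "x2 \<in> Gm"
  shows "tmult2 G Gp Gm (R_xe G Gp Gm \<xi> \<eta>) YY (u1 \<otimes> x1, u2 \<otimes> x2)
    = YY (lm (\<eta> u2) u1 \<otimes> (rm (\<eta> u2) u1 \<otimes> x1), rp u2 (\<xi> u1) \<otimes> (inv (\<xi> u1) \<otimes> x2))"
proof -
  have "tmult2 G Gp Gm (R_xe G Gp Gm \<xi> \<eta>) YY (u1 \<otimes> x1, u2 \<otimes> x2) = (\<Sum>a\<in>Gm. \<Sum>b\<in>Gm.
      if a = inv (rm (\<eta> u2) u1) then if b = \<xi> u1 then YY (rp u1 a \<otimes> (inv a \<otimes> x1), rp u2 b \<otimes> (inv b \<otimes> x2)) else 0 else 0)"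
    unfolding tmult2_eq[OF assms] using assms by (intro sum.cong refl) (simp add: R_xe_eq)
  then show ?thesis unfolding sum_if_const using assms by (simp add: mp_to_pm)
qed

lemma Rinv_left:
  assumes "u1 \<in> Gp" "x1 \<in> Gm" "u2 \<in> Gp" "x2 \<in> Gm"
  shows "tmult2 G Gp Gm Rinv YY (u1 \<otimes> x1, u2 \<otimes> x2)
    = YY (rp u1 (\<eta> u2) \<otimes> (inv (\<eta> u2) \<otimes> x1), rp u2 (inv (\<xi> (rp u1 (\<eta> u2)))) \<otimes> (\<xi> (rp u1 (\<eta> u2)) \<otimes> x2))"
proof -
  have "tmult2 G Gp Gm Rinv YY (u1 \<otimes> x1, u2 \<otimes> x2) = (\<Sum>a\<in>Gm. \<Sum>b\<in>Gm.
      if a = \<eta> u2 then if b = inv (\<xi> (rp u1 a)) then YY (rp u1 a \<otimes> (inv a \<otimes> x1), rp u2 b \<otimes> (inv b \<otimes> x2)) else 0 else 0)"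
    unfolding tmult2_eq[OF assms] using assms by (intro sum.cong refl) (simp add: Rinv_eq)
  then show ?thesis unfolding sum_if_const using assms by simp
qed

lemma inv_mult_eq_iff: "a \<in> carrier G \<Longrightarrow> b \<in> carrier G \<Longrightarrow> c \<in> carrier G \<Longrightarrow> inv a \<otimes> b = c \<longleftrightarrow> b = a \<otimes> c"
  by auto

text \<open>Acting by \<open>a\<close> and then by \<open>inv a \<otimes> x1\<close> is acting by
  \<open>x1\<close>, so the condition on the second label does not involve \<open>a\<close>. It
  fixes \<open>b\<close>, and then the first label follows.\<close>

lemma Rinv_right:
  assumes "u1 \<in> Gp" "x1 \<in> Gm" "u2 \<in> Gp" "x2 \<in> Gm"
  defines "b \<equiv> x2 \<otimes> \<xi> (rp u1 x1)"
  shows "tmult2 G Gp Gm YY Rinv (u1 \<otimes> x1, u2 \<otimes> x2)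
    = YY (u1 \<otimes> (x1 \<otimes> inv (\<eta> (rp u2 b))), u2 \<otimes> b)"
proof -
  have *: "inv a \<otimes> x = c \<longleftrightarrow> a = x \<otimes> inv c" if "a \<in> Gm" "x \<in> Gm" "c \<in> Gm" for a x c
    using that solve_cross(1)[of x "inv c" a \<one>] by auto
  have "tmult2 G Gp Gm YY Rinv (u1 \<otimes> x1, u2 \<otimes> x2) = (\<Sum>a\<in>Gm. \<Sum>b'\<in>Gm.
      if b' = b then if a = x1 \<otimes> inv (\<eta> (rp u2 b)) then YY (u1 \<otimes> (x1 \<otimes> inv (\<eta> (rp u2 b))), u2 \<otimes> b) else 0 else 0)"
    unfolding tmult2_eq[OF assms(1-4)] using assms
    by (intro sum.cong refl) (auto simp: Rinv_eq rp_mult[symmetric] *)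
  then show ?thesis unfolding sum_if_const using assms by simp
qed

context
  assumes eta_exchange: "\<And>u v. \<lbrakk>u \<in> Gp; v \<in> Gp\<rbrakk> \<Longrightarrow> rm (\<eta> v) u = \<eta> (rp v (\<xi> u))"
begin

lemma unit2_eqI:
  assumes "\<And>u1 x1 u2 x2. \<lbrakk>u1 \<in> Gp; x1 \<in> Gm; u2 \<in> Gp; x2 \<in> Gm\<rbrakk> \<Longrightarrow>
    tmult2 G Gp Gm XX YY (u1 \<otimes> x1, u2 \<otimes> x2) = (if x1 = \<one> then if x2 = \<one> then 1 else 0 else 0)"
  shows "tmult2 G Gp Gm XX YY = tunit2 Gp"
proof (rule ext, clarify)
  fix k1 k2
  show "tmult2 G Gp Gm XX YY (k1, k2) = tunit2 Gp (k1, k2)"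
  proof (cases "k1 \<in> carrier G \<and> k2 \<in> carrier G")
    case True
    then show ?thesis using assms by (auto simp: tunit2_def elim!: factor_obtain)
  next
    case False
    then show ?thesis by (auto simp: tmult2_outside tunit2_def hunit_outside)
  qed
qed

text \<open>\<open>eta_exchange\<close> makes \<open>rm (\<eta> u2) u1\<close> the label that
  \<open>Rinv\<close> has at the target of the arrow. This identity is the context assumption
  because both directions can supply it: one from \<open>exchange\<close>, the converse from a
  coproduct axiom.\<close>

lemma R_xe_Rinv: "tmult2 G Gp Gm (R_xe G Gp Gm \<xi> \<eta>) Rinv = tunit2 Gp"
proof (rule unit2_eqI)
  fix u1 x1 u2 x2 assume *: "u1 \<in> Gp" "x1 \<in> Gm" "u2 \<in> Gp" "x2 \<in> Gm"
  let ?r = "rm (\<eta> u2) u1"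
  have r: "?r \<in> Gm" "?r = \<eta> (rp u2 (\<xi> u1))" using * eta_exchange by auto
  have 1: "?r \<otimes> x1 = \<eta> (rp u2 (\<xi> u1)) \<longleftrightarrow> x1 = \<one>"
    unfolding r(2)[symmetric] using * by simp
  have 2: "rp (lm (\<eta> u2) u1) ?r = u1" using * by (simp add: mp_to_pm)
  have 3: "inv (\<xi> u1) \<otimes> x2 = inv (\<xi> u1) \<longleftrightarrow> x2 = \<one>" using * by simp
  show "tmult2 G Gp Gm (R_xe G Gp Gm \<xi> \<eta>) Rinv (u1 \<otimes> x1, u2 \<otimes> x2)
      = (if x1 = \<one> then if x2 = \<one> then 1 else 0 else 0)"
    using * by (simp add: R_xe_left Rinv_eq 1) (simp add: 2 3)
qed

lemma Rinv_R_xe: "tmult2 G Gp Gm Rinv (R_xe G Gp Gm \<xi> \<eta>) = tunit2 Gp"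
proof (rule unit2_eqI)
  fix u1 x1 u2 x2 assume *: "u1 \<in> Gp" "x1 \<in> Gm" "u2 \<in> Gp" "x2 \<in> Gm"
  let ?w = "rp u1 (\<eta> u2)"
  have w: "?w \<in> Gp" using * by simp
  have 1: "inv (rm (\<eta> (rp u2 (inv (\<xi> ?w)))) ?w) = inv (\<eta> u2)"
    using * w by (simp add: eta_exchange rp_mult[symmetric])
  show "tmult2 G Gp Gm Rinv (R_xe G Gp Gm \<xi> \<eta>) (u1 \<otimes> x1, u2 \<otimes> x2)
      = (if x1 = \<one> then if x2 = \<one> then 1 else 0 else 0)"
    using * w by (simp add: Rinv_left R_xe_eq 1)
qed

text \<open>Every \<open>(a, h)\<close> is the target of an arrow of \<open>R_xe\<close>, so by
  \<open>R_xe_left\<close> the product determines every value of the right factor.\<close>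

lemma right_inverse_unique:
  assumes "in_H2 G R'" "tmult2 G Gp Gm (R_xe G Gp Gm \<xi> \<eta>) R' = tunit2 Gp"
  shows "R' = Rinv"
proof (rule ext, clarify)
  fix k1 k2
  show "R' (k1, k2) = Rinv (k1, k2)"
  proof (cases "k1 \<in> carrier G \<and> k2 \<in> carrier G")
    case False
    then show ?thesis using assms(1) by (auto simp: in_H2_def Rinv_def)
  next
    case True
    then obtain a x h y where k: "a \<in> Gp" "x \<in> Gm" "k1 = a \<otimes> x" "h \<in> Gp" "y \<in> Gm" "k2 = h \<otimes> y"
      by (meson factor_obtain)
    \<comment> \<open>\<open>(u, v)\<close> is the source of the arrow of \<open>R_xe\<close> that
      ends at \<open>(a, h)\<close>.\<close>
    define u where "u = rp a (\<eta> h)"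
    define v where "v = rp h (inv (\<xi> u))"
    have uv: "u \<in> Gp" "v \<in> Gp" using k by (simp_all add: u_def v_def)
    have h: "rp v (\<xi> u) = h" using k uv by (simp add: v_def rp_mult[symmetric])
    have rm: "rm (\<eta> v) u = \<eta> h" using uv h eta_exchange by simp
    have "rp (lm (\<eta> v) u) (\<eta> h) = rp a (\<eta> h)"
      using uv mp_to_pm(4)[of "\<eta> v" u] rm by (simp add: u_def)
    then have lm: "lm (\<eta> v) u = a"
      using inj_onD[OF bij_betw_imp_inj_on[OF bij_rp[of "\<eta> h"]], of "lm (\<eta> v) u" a] k uv by simp
    have eq: "tmult2 G Gp Gm (R_xe G Gp Gm \<xi> \<eta>) Z (u \<otimes> (inv (\<eta> h) \<otimes> x), v \<otimes> (\<xi> u \<otimes> y)) = Z (k1, k2)" for Z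
      using k uv by (simp add: R_xe_left h rm lm)
    show ?thesis
      using eq[of R'] eq[of Rinv] assms(2) R_xe_Rinv by simp
  qed
qed

text \<open>Both outer factors only move the argument, so a single coefficient of the coproduct
  remains; the condition is that of \<open>hcop_eq\<close> at the moved argument.\<close>

lemma conjugate_hcop:
  assumes "u1 \<in> Gp" "x1 \<in> Gm" "u2 \<in> Gp" "x2 \<in> Gm"
  defines "b \<equiv> x2 \<otimes> \<xi> (rp u1 x1)" and "h \<equiv> rp u2 (\<xi> u1)"
  shows "tmult2 G Gp Gm (tmult2 G Gp Gm (R_xe G Gp Gm \<xi> \<eta>) (hcop G Gp Gm \<alpha>)) Rinv (u1 \<otimes> x1, u2 \<otimes> x2)
    = (if \<eta> h \<otimes> (x1 \<otimes> inv (\<eta> (rp u2 b))) = lp h (inv (\<xi> u1) \<otimes> b)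
       then \<alpha> (lm (\<eta> u2) u1 \<otimes> h \<otimes> (inv (\<xi> u1) \<otimes> b)) else 0)"
  using assms by (simp add: Rinv_right R_xe_left hcop_eq eta_exchange)

end

subsection \<open>The Hopf-theoretic axioms\<close>

text \<open>The second arrow starts at the moved source \<open>rp u3 (\<xi> u1)\<close>. The
  hypothesis turns its label into one built from \<open>rm (rm (\<eta> u3) u1) u2\<close>, and
  \<open>rm_mult\<close> and \<open>xi_mult\<close> then combine both arrows into the one at
  \<open>u1 \<otimes> u2\<close>.\<close>

lemma R_xe_cop_id:
  assumes "\<And>u v. \<lbrakk>u \<in> Gp; v \<in> Gp\<rbrakk> \<Longrightarrow> rm (\<eta> v) u = \<eta> (rp v (\<xi> u))"
  defines "R \<equiv> R_xe G Gp Gm \<xi> \<eta>"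
  shows "cop_id G Gp Gm R = tmult3 G Gp Gm (leg13 Gp R) (leg23 Gp R)"
proof (rule ext, clarify)
  fix k1 k2 k3
  show "cop_id G Gp Gm R (k1, k2, k3) = tmult3 G Gp Gm (leg13 Gp R) (leg23 Gp R) (k1, k2, k3)"
  proof (cases "k1 \<in> carrier G \<and> k2 \<in> carrier G \<and> k3 \<in> carrier G")
    case False
    then show ?thesis by (simp add: cop_outside tmult3_outside)
  next
    case True
    then obtain u1 x1 u2 x2 u3 x3 where k: "u1 \<in> Gp" "x1 \<in> Gm" "u2 \<in> Gp" "x2 \<in> Gm" "u3 \<in> Gp" "x3 \<in> Gm"
      and k_eq: "k1 = u1 \<otimes> x1" "k2 = u2 \<otimes> x2" "k3 = u3 \<otimes> x3"
      by (meson factor_obtain)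
    have "(\<Sum>a\<in>Gm. R (u1 \<otimes> x1, u3 \<otimes> a) * R (u2 \<otimes> x2, rp u3 a \<otimes> (inv a \<otimes> x3)))
      = (\<Sum>a\<in>Gm. if a = \<xi> u1 then if x1 = inv (rm (\<eta> u3) u1) then
           R (u2 \<otimes> x2, rp u3 a \<otimes> (inv a \<otimes> x3)) else 0 else 0)"
      using k by (intro sum.cong refl) (simp add: R_def R_xe_eq)
    also have "\<dots> = (if x1 = inv (rm (\<eta> u3) u1) then
        R (u2 \<otimes> x2, rp u3 (\<xi> u1) \<otimes> (inv (\<xi> u1) \<otimes> x3)) else 0)"
      using k by simp
    also have "\<dots> = (if x1 = inv (rm (\<eta> u3) u1) \<and> x2 = inv (rm (rm (\<eta> u3) u1) u2) \<and> x3 = \<xi> u1 \<otimes> \<xi> u2 then 1 else 0)"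
      using k assms(1)[symmetric] by (simp add: R_def R_xe_eq inv_mult_eq_iff)
    \<comment> \<open>\<open>mp_to_pm\<close> at \<open>rm (\<eta> u3) u1\<close> and
      \<open>u2\<close> trades the condition on \<open>x1\<close> for
      \<open>x1 = lp u2 x2\<close>.\<close>
    also have "\<dots> = (if x1 = lp u2 x2 then R (u1 \<otimes> u2 \<otimes> x2, u3 \<otimes> x3) else 0)"
      using k by (simp add: R_def R_xe_eq xi_mult rm_mult mp_to_pm)
    finally show ?thesis
      using k by (simp add: k_eq cop_id_eq tmult3_13_23)
  qed
qed

text \<open>Here the hypothesis matches the second labels, and the cocycle rule
  \<open>rm_mult_left\<close> combines the first labels into the one for
  \<open>\<eta> (u2 \<otimes> u3)\<close>.\<close>

lemma R_xe_id_cop: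
  assumes "\<And>u v. \<lbrakk>u \<in> Gp; v \<in> Gp\<rbrakk> \<Longrightarrow> \<xi> (lm (\<eta> v) u) = lp v (\<xi> u)"
  defines "R \<equiv> R_xe G Gp Gm \<xi> \<eta>"
  shows "id_cop G Gp Gm R = tmult3 G Gp Gm (leg13 Gp R) (leg12 Gp R)"
proof (rule ext, clarify)
  fix k1 k2 k3
  show "id_cop G Gp Gm R (k1, k2, k3) = tmult3 G Gp Gm (leg13 Gp R) (leg12 Gp R) (k1, k2, k3)"
  proof (cases "k1 \<in> carrier G \<and> k2 \<in> carrier G \<and> k3 \<in> carrier G")
    case False
    then show ?thesis by (simp add: cop_outside tmult3_outside)
  next
    case True
    then obtain u1 x1 u2 x2 u3 x3 where k: "u1 \<in> Gp" "x1 \<in> Gm" "u2 \<in> Gp" "x2 \<in> Gm" "u3 \<in> Gp" "x3 \<in> Gm"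
      and k_eq: "k1 = u1 \<otimes> x1" "k2 = u2 \<otimes> x2" "k3 = u3 \<otimes> x3"
      by (meson factor_obtain)
    let ?r = "rm (\<eta> u3) u1"
    have "(\<Sum>a\<in>Gm. R (u1 \<otimes> a, u3 \<otimes> x3) * R (rp u1 a \<otimes> (inv a \<otimes> x1), u2 \<otimes> x2))
      = (\<Sum>a\<in>Gm. if a = inv ?r then if x3 = \<xi> u1 then R (rp u1 a \<otimes> (inv a \<otimes> x1), u2 \<otimes> x2) else 0 else 0)"
      using k by (intro sum.cong refl) (simp add: R_def R_xe_eq)
    also have "\<dots> = (if x3 = \<xi> u1 then R (lm (\<eta> u3) u1 \<otimes> (?r \<otimes> x1), u2 \<otimes> x2) else 0)"
      using k by (simp add: mp_to_pm)
    also have "\<dots> = (if x3 = \<xi> u1 \<and> ?r \<otimes> x1 = inv (rm (\<eta> u2) (lm (\<eta> u3) u1)) \<and> x2 = lp u3 (\<xi> u1) then 1 else 0)"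
      using k assms(1) by (simp add: R_def R_xe_eq)
    also have "?r \<otimes> x1 = inv (rm (\<eta> u2) (lm (\<eta> u3) u1)) \<longleftrightarrow> x1 = inv (rm (\<eta> (u2 \<otimes> u3)) u1)"
      using k inv_mult_eq_iff[of ?r "inv (rm (\<eta> u2) (lm (\<eta> u3) u1))" x1]
      by (auto simp: eta_mult rm_mult_left inv_mult_group)
    also have "(if x3 = \<xi> u1 \<and> x1 = inv (rm (\<eta> (u2 \<otimes> u3)) u1) \<and> x2 = lp u3 (\<xi> u1) then 1 else 0)
      = (if x2 = lp u3 x3 then R (u1 \<otimes> x1, u2 \<otimes> u3 \<otimes> x3) else 0)"
      using k by (auto simp: R_def R_xe_eq)
    finally show ?thesis
      using k by (simp add: k_eq id_cop_eq tmult3_13_12)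
  qed
qed

lemma R_xe_eps_id: "eps_id G Gp Gm (R_xe G Gp Gm \<xi> \<eta>) = hunit Gp"
proof
  fix k
  show "eps_id G Gp Gm (R_xe G Gp Gm \<xi> \<eta>) k = hunit Gp k"
  proof (cases "k \<in> carrier G")
    case True
    then obtain v y where k: "v \<in> Gp" "y \<in> Gm" "k = v \<otimes> y" by (rule factor_obtain)
    have "(\<Sum>x\<in>Gm. R_xe G Gp Gm \<xi> \<eta> (x, k)) = (\<Sum>x\<in>Gm. if x = inv (\<eta> v) then if y = \<one> then 1 else 0 else 0)"
      using k R_xe_eq[of \<one> _ v y] by (intro sum.cong refl) simp
    then show ?thesis using True k by (simp add: eps_id_eq)
  qed (simp add: eps_outside hunit_outside)
qed

lemma R_xe_id_eps: "id_eps G Gp Gm (R_xe G Gp Gm \<xi> \<eta>) = hunit Gp"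
proof
  fix k
  show "id_eps G Gp Gm (R_xe G Gp Gm \<xi> \<eta>) k = hunit Gp k"
  proof (cases "k \<in> carrier G")
    case True
    then obtain u x where k: "u \<in> Gp" "x \<in> Gm" "k = u \<otimes> x" by (rule factor_obtain)
    have "(\<Sum>y\<in>Gm. R_xe G Gp Gm \<xi> \<eta> (k, y)) = (\<Sum>y\<in>Gm. if y = \<xi> u then if x = \<one> then 1 else 0 else 0)"
      using k R_xe_eq[of u x \<one>] by (intro sum.cong refl) simp
    then show ?thesis using True k by (simp add: id_eps_eq)
  qed (simp add: eps_outside hunit_outside)
qed

text \<open>Each side is one coefficient of \<open>\<alpha>\<close> under a condition on labels.
  Equivariance of \<open>\<eta>\<close> and then of \<open>\<xi>\<close> identifies the conditions;
  under them \<open>x = x1\<close>, and the exchange identity equates the \<open>Gp\<close>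
  components.\<close>

lemma R_xe_intertwines:
  assumes "equivariant \<xi>" "equivariant \<eta>" "exchange \<xi> \<eta>"
  shows "flip2 (hcop G Gp Gm \<alpha>) = tmult2 G Gp Gm (tmult2 G Gp Gm (R_xe G Gp Gm \<xi> \<eta>) (hcop G Gp Gm \<alpha>)) Rinv"
proof (rule ext, clarify)
  fix k1 k2
  show "flip2 (hcop G Gp Gm \<alpha>) (k1, k2) = tmult2 G Gp Gm (tmult2 G Gp Gm (R_xe G Gp Gm \<xi> \<eta>) (hcop G Gp Gm \<alpha>)) Rinv (k1, k2)"
  proof (cases "k1 \<in> carrier G \<and> k2 \<in> carrier G")
    case False
    then show ?thesis by (auto simp: flip2_def hcop_outside tmult2_outside)
  next
    case True
    then obtain u1 x1 u2 x2 where k: "u1 \<in> Gp" "x1 \<in> Gm" "u2 \<in> Gp" "x2 \<in> Gm"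
      and k_eq: "k1 = u1 \<otimes> x1" "k2 = u2 \<otimes> x2"
      by (meson factor_obtain)
    \<comment> \<open>\<open>h\<close> and \<open>x\<close> are the components of the second leg at
      which the coproduct is evaluated after conjugation.\<close>
    define b h x where "b = x2 \<otimes> \<xi> (rp u1 x1)" and "h = rp u2 (\<xi> u1)" and "x = inv (\<xi> u1) \<otimes> b"
    have c: "b \<in> Gm" "h \<in> Gp" "x \<in> Gm" using k by (simp_all add: b_def h_def x_def)
    have b: "b = \<xi> u1 \<otimes> x" using k c by (simp add: x_def)
    have hx: "rp u2 b = rp h x" using k c by (simp add: b rp_mult h_def)
    have "\<eta> h \<otimes> (x1 \<otimes> inv (\<eta> (rp h x))) = lp h x \<longleftrightarrow> \<eta> h \<otimes> x1 = lp h x \<otimes> \<eta> (rp h x)"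
      using k c solve_cross(1)[of "\<eta> h \<otimes> x1" "inv (\<eta> (rp h x))" "lp h x" \<one>]
        solve_cross(1)[of "\<eta> h \<otimes> x1" \<one> "lp h x" "\<eta> (rp h x)"]
      by (simp add: m_assoc inv_solve_right')
    also have "\<dots> \<longleftrightarrow> \<eta> h \<otimes> x1 = \<eta> h \<otimes> x"
      using k c equivariantD[OF assms(2), of h x] by simp
    also have "\<dots> \<longleftrightarrow> \<xi> u1 \<otimes> x1 = b" using k c by (simp add: b)
    also have "\<dots> \<longleftrightarrow> x2 = lp u1 x1"
      using k c equivariantD[OF assms(1), of u1 x1] by (auto simp: b_def)
    finally have 1: "\<eta> h \<otimes> (x1 \<otimes> inv (\<eta> (rp h x))) = lp h x \<longleftrightarrow> x2 = lp u1 x1" .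
    have "x = x1" if "x2 = lp u1 x1"
      using k c equivariantD[OF assms(1), of u1 x1] that by (simp add: x_def b_def inv_mult_eq_iff)
    moreover have "lm (\<eta> u2) u1 \<otimes> h = u2 \<otimes> u1"
      using exchangeD[OF assms(3)] k by (simp add: h_def)
    ultimately show ?thesis
      using k conjugate_hcop[OF exchange_eta[OF assms(2,3)] k, of \<alpha>, folded b_def h_def, folded x_def]
      unfolding k_eq hx 1 by (auto simp: flip2_def hcop_eq)
  qed
qed

lemma R_xe_quasi_triangular:
  assumes "equivariant \<xi>" "equivariant \<eta>" "exchange \<xi> \<eta>"
  shows "quasi_triangular G Gp Gm (R_xe G Gp Gm \<xi> \<eta>)"
  unfolding quasi_triangular_def
proof (intro conjI exI[of _ Rinv] allI impI)
  show "in_H2 G (R_xe G Gp Gm \<xi> \<eta>)" "in_H2 G Rinv"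
    using R_xe_outside by (auto simp: in_H2_def Rinv_def)
qed (use assms in \<open>simp_all add: R_xe_intertwines R_xe_eps_id R_xe_id_eps R_xe_cop_id R_xe_id_cop
      exchange_eta exchange_xi R_xe_Rinv Rinv_R_xe\<close>)

lemma quasi_triangular_R_xe_imp:
  assumes "\<And>u v. \<lbrakk>u \<in> Gp; v \<in> Gp\<rbrakk> \<Longrightarrow> rm (\<eta> v) u = \<eta> (rp v (\<xi> u))"
    and "quasi_triangular G Gp Gm (R_xe G Gp Gm \<xi> \<eta>)"
  shows "equivariant \<xi> \<and> equivariant \<eta> \<and> exchange \<xi> \<eta>"
proof -
  \<comment> \<open>The inverse in \<open>quasi_triangular\<close> is only asserted to exist;
    uniqueness makes it \<open>Rinv\<close>.\<close>
  have intertwine: "flip2 (hcop G Gp Gm \<alpha>) = tmult2 G Gp Gm (tmult2 G Gp Gm (R_xe G Gp Gm \<xi> \<eta>) (hcop G Gp Gm \<alpha>)) Rinv"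
    if "in_H G \<alpha>" for \<alpha>
    using assms(2) right_inverse_unique[OF assms(1)] that unfolding quasi_triangular_def by metis
  have main: "lm (\<eta> u2) u1 \<otimes> rp u2 (\<xi> u1) = u2 \<otimes> u1 \<and> \<xi> u1 \<otimes> x1 = lp u1 x1 \<otimes> \<xi> (rp u1 x1) \<and>
      (let h = rp u2 (\<xi> u1) in \<eta> h \<otimes> (x1 \<otimes> inv (\<eta> (rp h x1))) = lp h x1)"
    if k: "u1 \<in> Gp" "x1 \<in> Gm" "u2 \<in> Gp" for u1 x1 u2
  proof -
    define x2 where "x2 = lp u1 x1"
    define b h x where "b = x2 \<otimes> \<xi> (rp u1 x1)" and "h = rp u2 (\<xi> u1)" and "x = inv (\<xi> u1) \<otimes> b"
    have c: "b \<in> Gm" "h \<in> Gp" "x \<in> Gm" "x2 \<in> Gm" using k by (simp_all add: b_def h_def x_def x2_def)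
    have b: "b = \<xi> u1 \<otimes> x" using k c by (simp add: x_def)
    have hx: "rp u2 b = rp h x" using k c by (simp add: b rp_mult h_def)
    \<comment> \<open>A basis element for which the left side is 1 at this argument. The right side
      then forces both its condition and, by unique factorization, equality of the
      components.\<close>
    define \<alpha> :: "'a \<Rightarrow> complex" where "\<alpha> = (\<lambda>g. if g = u2 \<otimes> u1 \<otimes> x1 then 1 else 0)"
    have "in_H G \<alpha>" using k by (auto simp: in_H_def \<alpha>_def)
    have "1 = flip2 (hcop G Gp Gm \<alpha>) (u1 \<otimes> x1, u2 \<otimes> x2)"
      using k c by (simp add: flip2_def hcop_eq x2_def \<alpha>_def)
    also have "\<dots> = (if \<eta> h \<otimes> (x1 \<otimes> inv (\<eta> (rp h x))) = lp h x then \<alpha> (lm (\<eta> u2) u1 \<otimes> h \<otimes> x) else 0)"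
      unfolding intertwine[OF \<open>in_H G \<alpha>\<close>]
      using conjugate_hcop[OF assms(1) k(1,2,3) c(4), of \<alpha>]
      by (simp add: b_def[symmetric] h_def[symmetric] x_def[symmetric] hx)
    finally have 1: "\<eta> h \<otimes> (x1 \<otimes> inv (\<eta> (rp h x))) = lp h x" "lm (\<eta> u2) u1 \<otimes> h \<otimes> x = u2 \<otimes> u1 \<otimes> x1"
      by (auto simp: \<alpha>_def split: if_splits)
    then have 2: "lm (\<eta> u2) u1 \<otimes> h = u2 \<otimes> u1" "x = x1"
      using k c by simp_all
    show ?thesis using 1 2 b by (simp add: b_def h_def[symmetric] x2_def Let_def)
  qed
  \<comment> \<open>At \<open>u1 = \<one>\<close> the index \<open>h = rp u (\<xi> \<one>)\<close>
    is \<open>u\<close> itself, hence arbitrary.\<close>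
  have "\<eta> u \<otimes> x = lp u x \<otimes> \<eta> (rp u x)" if "u \<in> Gp" "x \<in> Gm" for u x
    using main[of \<one> x u] that
      solve_cross(1)[of "\<eta> u \<otimes> x" "inv (\<eta> (rp u x))" "lp u x" \<one>]
      solve_cross(1)[of "\<eta> u \<otimes> x" \<one> "lp u x" "\<eta> (rp u x)"]
    by (simp add: m_assoc)
  then show ?thesis
    using main main[of _ \<one>] by (simp add: equivariant_def exchange_def)
qed

subsection \<open>Normality and the isomorphism\<close>

lemma inv_image_Gp: "(\<lambda>u. inv u) ` Gp = Gp"
proof
  show "Gp \<subseteq> (\<lambda>u. inv u) ` Gp"
  proof
    fix u assume "u \<in> Gp"
    then have "inv u \<in> Gp" "u = inv (inv u)" by simp_all
    then show "u \<in> (\<lambda>u. inv u) ` Gp" by (rule rev_image_eqI)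
  qed
qed auto

lemma Gp'_eq: "Gp' G Gp \<xi> = (\<lambda>u. inv u \<otimes> \<xi> u) ` Gp"
proof -
  have "Gp' G Gp \<xi> = (\<lambda>u. inv u \<otimes> \<xi> u) ` (\<lambda>u. inv u) ` Gp"
    unfolding Gp'_def image_image by (intro image_cong refl) simp
  then show ?thesis by (simp add: inv_image_Gp)
qed

text \<open>\<open>Gp''\<close> consists of the inverses of the twisted elements for
  \<open>\<eta>\<close>, which lets the results on twisted elements serve both subgroups.\<close>

lemma Gp''_eq: "Gp'' G Gp \<eta> = (\<lambda>u. inv (inv u \<otimes> \<eta> u)) ` Gp"
  unfolding Gp''_def by (intro image_cong refl) (simp add: eta_inv inv_mult_group)

text \<open>In the new form each side is the index of a product of the elements with indices
  \<open>u\<close> and \<open>inv v\<close>, computed in \<open>Gp'\<close> on the left and through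
  \<open>F\<close> in \<open>Gp''\<close> on the right.\<close>

lemma exchange_iff:
  assumes "u \<in> Gp" "v \<in> Gp"
  shows "lm (\<eta> v) u \<otimes> rp v (\<xi> u) = v \<otimes> u
    \<longleftrightarrow> u \<otimes> lm (inv (\<xi> u)) (inv v) = inv v \<otimes> lm (\<eta> v) u"
  using assms solve_cross(2)[of v u "lm (\<eta> v) u" "rp v (\<xi> u)"] by (auto simp: lm_inv)

text \<open>By normality the conjugate of a twisted element by \<open>inv x\<close> is twisted. Its
  \<open>Gp\<close> component identifies the index as \<open>rp u x\<close>, and its
  \<open>Gm\<close> component is then equivariance. Multiplicativity of \<open>F\<close> gives the
  exchange identity.\<close>

lemma admissible_imp:
  assumes "admissible_pair G Gp Gm \<xi> \<eta>"
  shows "equivariant \<xi>" "equivariant \<eta>" "exchange \<xi> \<eta>"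
proof -
  have norm: "Gp' G Gp \<xi> \<lhd> G" "Gp'' G Gp \<eta> \<lhd> G"
    using assms by (auto simp: admissible_pair_def)
  show "equivariant \<xi>"
    unfolding equivariant_def
  proof (intro ballI)
    fix u x assume *: "u \<in> Gp" "x \<in> Gm"
    let ?w = "rp u x" and ?y = "lp u x"
    have "inv x \<otimes> (inv u \<otimes> \<xi> u) \<otimes> x \<in> Gp' G Gp \<xi>"
      using * by (intro normal.inv_op_closed1[OF norm(1)]) (auto simp: Gp'_eq)
    then obtain w where w: "w \<in> Gp" "inv x \<otimes> (inv u \<otimes> \<xi> u) \<otimes> x = inv w \<otimes> \<xi> w"
      by (auto simp: Gp'_eq)
    have "inv x \<otimes> inv u = inv ?w \<otimes> inv ?y"
      using * pm_prod(1)[of u x] by (simp flip: inv_mult_group)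
    then have "inv x \<otimes> (inv u \<otimes> \<xi> u) \<otimes> x = inv ?w \<otimes> (inv ?y \<otimes> (\<xi> u \<otimes> x))"
      using * by (simp flip: m_assoc)
    with w * have "inv ?w = inv w" "inv ?y \<otimes> (\<xi> u \<otimes> x) = \<xi> w" by simp_all
    then show "\<xi> u \<otimes> x = ?y \<otimes> \<xi> ?w"
      using * w by (simp add: inv_mult_eq_iff inv_inj[THEN inj_on_eq_iff])
  qed
  show "equivariant \<eta>"
    unfolding equivariant_def
  proof (intro ballI)
    fix u x assume *: "u \<in> Gp" "x \<in> Gm"
    let ?w = "rp u x" and ?y = "lp u x"
    have "inv x \<otimes> inv (inv u \<otimes> \<eta> u) \<otimes> x \<in> Gp'' G Gp \<eta>"
      using * by (intro normal.inv_op_closed1[OF norm(2)]) (auto simp: Gp''_eq)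
    then obtain w where w: "w \<in> Gp" "inv x \<otimes> inv (inv u \<otimes> \<eta> u) \<otimes> x = inv (inv w \<otimes> \<eta> w)"
      by (auto simp: Gp''_eq)
    \<comment> \<open>Inverting brings elements of \<open>Gp''\<close> to the form
      \<open>inv w \<otimes> \<eta> w\<close>, so the argument for \<open>\<xi>\<close>
      applies.\<close>
    have "inv x \<otimes> inv (inv u \<otimes> \<eta> u) \<otimes> x = inv (inv x \<otimes> (inv u \<otimes> \<eta> u) \<otimes> x)"
      using * by (simp add: inv_mult_group m_assoc)
    then have "inv x \<otimes> (inv u \<otimes> \<eta> u) \<otimes> x = inv w \<otimes> \<eta> w"
      using * w by (simp add: inv_inj[THEN inj_on_eq_iff])
    moreover have "inv x \<otimes> inv u = inv ?w \<otimes> inv ?y"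
      using * pm_prod(1)[of u x] by (simp flip: inv_mult_group)
    then have "inv x \<otimes> (inv u \<otimes> \<eta> u) \<otimes> x = inv ?w \<otimes> (inv ?y \<otimes> (\<eta> u \<otimes> x))"
      using * by (simp flip: m_assoc)
    ultimately have "inv ?w = inv w" "inv ?y \<otimes> (\<eta> u \<otimes> x) = \<eta> w" using w * by simp_all
    then show "\<eta> u \<otimes> x = ?y \<otimes> \<eta> ?w"
      using * w by (simp add: inv_mult_eq_iff inv_inj[THEN inj_on_eq_iff])
  qed
  obtain F where F: "\<And>u. u \<in> Gp \<Longrightarrow> F (u \<otimes> \<xi> (inv u)) = \<eta> u \<otimes> inv u"
    and F_iso: "F \<in> iso (G\<lparr>carrier := Gp' G Gp \<xi>\<rparr>) (G\<lparr>carrier := Gp'' G Gp \<eta>\<rparr>)"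
    using assms by (auto simp: admissible_pair_def)
  have mem: "u \<otimes> \<xi> (inv u) \<in> Gp' G Gp \<xi>" if "u \<in> Gp" for u
    using that by (auto simp: Gp'_def)
  \<comment> \<open>The index \<open>w\<close> of a product in \<open>Gp'\<close> is computed twice:
    directly, and from its image under \<open>F\<close>, where elements factor in the order
    \<open>Gm\<close>, \<open>Gp\<close>.\<close>
  have key: "u \<otimes> lm (inv (\<xi> u)) v = v \<otimes> lm (inv (\<eta> v)) u" if *: "u \<in> Gp" "v \<in> Gp" for u v
  proof -
    let ?P = "(u \<otimes> \<xi> (inv u)) \<otimes> (v \<otimes> \<xi> (inv v))"
    have "?P \<in> Gp' G Gp \<xi>"
      using * norm(1) mem by (auto intro: subgroup.m_closed normal_imp_subgroup)
    then obtain w where w: "w \<in> Gp" "?P = w \<otimes> \<xi> (inv w)"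
      by (auto simp: Gp'_def)
    have "?P = (u \<otimes> lm (inv (\<xi> u)) v) \<otimes> (rm (inv (\<xi> u)) v \<otimes> \<xi> (inv v))"
    proof -
      have "?P = u \<otimes> (inv (\<xi> u) \<otimes> v) \<otimes> \<xi> (inv v)"
        using * by (simp add: m_assoc xi_inv)
      then show ?thesis using * by (simp add: m_assoc mp_prod(1)[of "inv (\<xi> u)" v])
    qed
    with w * have w1: "w = u \<otimes> lm (inv (\<xi> u)) v"
      using factor_unique(1)[of w "u \<otimes> lm (inv (\<xi> u)) v" "\<xi> (inv w)" "rm (inv (\<xi> u)) v \<otimes> \<xi> (inv v)"] by simp
    have "\<eta> w \<otimes> inv w = F ?P" using w F by simp
    also have "\<dots> = (\<eta> u \<otimes> inv u) \<otimes> (\<eta> v \<otimes> inv v)"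
      using F_iso mem * F by (simp add: iso_def hom_def)
    also have "\<dots> = \<eta> u \<otimes> (inv u \<otimes> \<eta> v) \<otimes> inv v"
      using * by (simp add: m_assoc)
    also have "\<dots> = (\<eta> u \<otimes> lp (inv u) (\<eta> v)) \<otimes> (rp (inv u) (\<eta> v) \<otimes> inv v)"
      using * by (simp add: m_assoc pm_prod(1)[of "inv u" "\<eta> v"])
    finally have "inv w = rp (inv u) (\<eta> v) \<otimes> inv v"
      using w * factor_unique_rev(1)[of "inv w" "rp (inv u) (\<eta> v) \<otimes> inv v" "\<eta> w" "\<eta> u \<otimes> lp (inv u) (\<eta> v)"] by simp
    from arg_cong[OF this, of "\<lambda>g. inv g"] have "w = v \<otimes> inv (rp (inv u) (\<eta> v))"
      using w * by (simp add: inv_mult_group)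
    then show ?thesis using w1 * lm_inv[of "\<eta> v" "inv u"] by simp
  qed
  show "exchange \<xi> \<eta>"
    unfolding exchange_def
  proof (intro ballI)
    fix u v assume *: "u \<in> Gp" "v \<in> Gp"
    show "lm (\<eta> v) u \<otimes> rp v (\<xi> u) = v \<otimes> u"
      using key[of u "inv v"] * by (simp add: exchange_iff eta_inv)
  qed
qed

lemma admissible_pairI:
  assumes "equivariant \<xi>" "equivariant \<eta>" "exchange \<xi> \<eta>"
  shows "admissible_pair G Gp Gm \<xi> \<eta>"
proof -
  have norm1: "Gp' G Gp \<xi> \<lhd> G"
    unfolding Gp'_eq using assms(1) by (intro normal_twist) (simp_all add: xi_mult)
  have normE: "(\<lambda>u. inv u \<otimes> \<eta> u) ` Gp \<lhd> G" (is "?N \<lhd> G")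
    using assms(2) by (intro normal_twist) (simp_all add: eta_mult)
  have "Gp'' G Gp \<eta> = (\<lambda>n. inv n) ` ?N"
    by (simp add: Gp''_eq image_image)
  \<comment> \<open>A subgroup is closed under inversion, so it equals its set of inverses.\<close>
  also have "\<dots> = ?N"
  proof
    show sub: "(\<lambda>n. inv n) ` ?N \<subseteq> ?N"
      using subgroup.m_inv_closed[OF normal_imp_subgroup[OF normE]] by blast
    show "?N \<subseteq> (\<lambda>n. inv n) ` ?N"
    proof
      fix n assume n: "n \<in> ?N"
      then have "n = inv (inv n)" using subgroup.mem_carrier[OF normal_imp_subgroup[OF normE]] by simp
      with n sub show "n \<in> (\<lambda>n. inv n) ` ?N" by blast
    qed
  qed
  finally have norm2: "Gp'' G Gp \<eta> \<lhd> G" using normE by simp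
  \<comment> \<open>An element of \<open>Gp'\<close> is determined by its \<open>Gp\<close>
    component, from which its image can be read off.\<close>
  define F where "F g = \<eta> (fp g) \<otimes> inv (fp g)" for g
  have F: "F (u \<otimes> \<xi> (inv u)) = \<eta> u \<otimes> inv u" if "u \<in> Gp" for u
    using that by (simp add: F_def)
  have Q: "\<eta> u \<otimes> inv u = inv (inv (inv u) \<otimes> \<eta> (inv u))" if "u \<in> Gp" for u
    using that by (simp add: eta_inv inv_mult_group)
  have mult: "F ((u \<otimes> \<xi> (inv u)) \<otimes> (v \<otimes> \<xi> (inv v))) = F (u \<otimes> \<xi> (inv u)) \<otimes> F (v \<otimes> \<xi> (inv v))"
    if *: "u \<in> Gp" "v \<in> Gp" for u v
  proof -
    \<comment> \<open>The index of the product in \<open>Gp'\<close>, obtained by inverting the one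
      in \<open>twist_mult\<close> at \<open>inv u\<close> and \<open>inv v\<close>.\<close>
    let ?w = "u \<otimes> inv (rp (inv v) (\<xi> u))"
    have w: "?w \<in> Gp" "inv ?w = rp (inv v) (\<xi> u) \<otimes> inv u" using * by (simp_all add: inv_mult_group)
    have "(u \<otimes> \<xi> (inv u)) \<otimes> (v \<otimes> \<xi> (inv v)) = ?w \<otimes> \<xi> (inv ?w)"
      using twist_mult[of \<xi> "inv u" "inv v"] assms(1) * w by (simp add: xi_mult xi_inv inv_mult_group)
    then have "F ((u \<otimes> \<xi> (inv u)) \<otimes> (v \<otimes> \<xi> (inv v))) = \<eta> ?w \<otimes> inv ?w"
      using F[OF w(1)] by simp
    \<comment> \<open>The exchange identity enters here, rewriting the index from its
      \<open>\<xi>\<close> form to its \<open>\<eta>\<close> form.\<close>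
    moreover have "?w = v \<otimes> inv (rp (inv u) (\<eta> v))"
      using exchangeD[OF assms(3), of u "inv v"] exchange_iff[of u "inv v"] *
        lm_inv[of "\<xi> u" "inv v"] lm_inv[of "\<eta> v" "inv u"] by (simp add: eta_inv)
    moreover have "(\<eta> u \<otimes> inv u) \<otimes> (\<eta> v \<otimes> inv v)
        = inv ((inv (inv v) \<otimes> \<eta> (inv v)) \<otimes> (inv (inv u) \<otimes> \<eta> (inv u)))"
      using * by (simp add: Q inv_mult_group)
    moreover have "\<dots> = inv (inv (rp (inv u) (\<eta> v) \<otimes> inv v) \<otimes> \<eta> (rp (inv u) (\<eta> v) \<otimes> inv v))"
      using twist_mult[of \<eta> "inv v" "inv u"] assms(2) * by (simp add: eta_mult eta_inv)
    moreover have "rp (inv u) (\<eta> v) \<otimes> inv v = inv (v \<otimes> inv (rp (inv u) (\<eta> v)))"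
      using * by (simp add: inv_mult_group)
    ultimately show ?thesis using F * Q[OF w(1)] by simp
  qed
  have "F \<in> iso (G\<lparr>carrier := Gp' G Gp \<xi>\<rparr>) (G\<lparr>carrier := Gp'' G Gp \<eta>\<rparr>)"
  proof (rule isoI)
    have img: "F ` Gp' G Gp \<xi> = Gp'' G Gp \<eta>"
    proof -
      have "F ` Gp' G Gp \<xi> = (\<lambda>u. \<eta> (inv u) \<otimes> u) ` (\<lambda>u. inv u) ` Gp"
        unfolding Gp'_def image_image by (intro image_cong refl) (simp add: F)
      then show ?thesis by (simp add: Gp''_def inv_image_Gp)
    qed
    have "inj_on F (Gp' G Gp \<xi>)"
    proof (rule inj_onI)
      fix g h assume "g \<in> Gp' G Gp \<xi>" "h \<in> Gp' G Gp \<xi>" and eq: "F g = F h"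
      then obtain u v where uv: "u \<in> Gp" "g = u \<otimes> \<xi> (inv u)" "v \<in> Gp" "h = v \<otimes> \<xi> (inv v)"
        by (auto simp: Gp'_def)
      then have "inv u = inv v"
        using eq factor_unique_rev(1)[of "inv u" "inv v" "\<eta> u" "\<eta> v"] by (simp add: F)
      then show "g = h" using uv by (simp add: inv_inj[THEN inj_on_eq_iff])
    qed
    with img show "bij_betw F (carrier (G\<lparr>carrier := Gp' G Gp \<xi>\<rparr>)) (carrier (G\<lparr>carrier := Gp'' G Gp \<eta>\<rparr>))"
      by (simp add: bij_betw_def)
    show "F \<in> hom (G\<lparr>carrier := Gp' G Gp \<xi>\<rparr>) (G\<lparr>carrier := Gp'' G Gp \<eta>\<rparr>)"
      using img mult by (auto simp: hom_def Gp'_def)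
  qed
  with F norm1 norm2 hom_xi hom_eta show ?thesis
    unfolding admissible_pair_def by blast
qed

end

subsection \<open>Positive R-matrices\<close>

locale positive_R_matrix = factorized_group G Gp Gm for G (structure) and Gp Gm +
  fixes R :: "'a \<times> 'a \<Rightarrow> complex"
  assumes positive: "positive2 R" and quasi: "quasi_triangular G Gp Gm R"
begin

text \<open>Taking real parts loses nothing for positive \<open>R\<close> and makes order arguments
  available.\<close>

definition coef :: "'a \<Rightarrow> 'a \<Rightarrow> 'a \<Rightarrow> 'a \<Rightarrow> real" where
  "coef u x v y = Re (R (u \<otimes> x, v \<otimes> y))"

lemma R_eq: "R p = of_real (Re (R p))"
  using positive by (simp add: positive2_def complex_eq_iff del: split_paired_All)

lemma R_coef: "R (u \<otimes> x, v \<otimes> y) = of_real (coef u x v y)"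
  unfolding coef_def by (rule R_eq)

lemma coef_nonneg [simp]: "coef u x v y \<ge> 0"
  using positive by (simp add: coef_def positive2_def)

lemma coef_cop_id:
  assumes "u1 \<in> Gp" "x1 \<in> Gm" "u2 \<in> Gp" "x2 \<in> Gm" "u3 \<in> Gp" "x3 \<in> Gm"
  shows "(if x1 = lp u2 x2 then coef (u1 \<otimes> u2) x2 u3 x3 else 0)
    = (\<Sum>a\<in>Gm. coef u1 x1 u3 a * coef u2 x2 (rp u3 a) (inv a \<otimes> x3))"
proof -
  have "cop_id G Gp Gm R (u1 \<otimes> x1, u2 \<otimes> x2, u3 \<otimes> x3)
      = tmult3 G Gp Gm (leg13 Gp R) (leg23 Gp R) (u1 \<otimes> x1, u2 \<otimes> x2, u3 \<otimes> x3)"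
    using quasi by (simp add: quasi_triangular_def)
  then have "complex_of_real (if x1 = lp u2 x2 then coef (u1 \<otimes> u2) x2 u3 x3 else 0)
      = of_real (\<Sum>a\<in>Gm. coef u1 x1 u3 a * coef u2 x2 (rp u3 a) (inv a \<otimes> x3))"
    using assms by (auto simp: cop_id_eq tmult3_13_23 R_coef split: if_splits)
  then show ?thesis unfolding of_real_eq_iff .
qed

lemma coef_id_cop:
  assumes "u1 \<in> Gp" "x1 \<in> Gm" "u2 \<in> Gp" "x2 \<in> Gm" "u3 \<in> Gp" "x3 \<in> Gm"
  shows "(if x2 = lp u3 x3 then coef u1 x1 (u2 \<otimes> u3) x3 else 0)
    = (\<Sum>a\<in>Gm. coef u1 a u3 x3 * coef (rp u1 a) (inv a \<otimes> x1) u2 x2)"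
proof -
  have "id_cop G Gp Gm R (u1 \<otimes> x1, u2 \<otimes> x2, u3 \<otimes> x3)
      = tmult3 G Gp Gm (leg13 Gp R) (leg12 Gp R) (u1 \<otimes> x1, u2 \<otimes> x2, u3 \<otimes> x3)"
    using quasi by (simp add: quasi_triangular_def)
  then have "complex_of_real (if x2 = lp u3 x3 then coef u1 x1 (u2 \<otimes> u3) x3 else 0)
      = of_real (\<Sum>a\<in>Gm. coef u1 a u3 x3 * coef (rp u1 a) (inv a \<otimes> x1) u2 x2)"
    using assms by (auto simp: id_cop_eq tmult3_13_12 R_coef split: if_splits)
  then show ?thesis unfolding of_real_eq_iff .
qed

lemma coef_eps_id:
  assumes "v \<in> Gp" "y \<in> Gm"
  shows "(\<Sum>x\<in>Gm. coef \<one> x v y) = (if y = \<one> then 1 else 0)"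
proof -
  have "eps_id G Gp Gm R (v \<otimes> y) = hunit Gp (v \<otimes> y)"
    using quasi by (simp add: quasi_triangular_def)
  then have "(\<Sum>x\<in>Gm. R (x, v \<otimes> y)) = (if y = \<one> then 1 else 0)"
    using assms by (simp add: eps_id_eq)
  moreover have "(\<Sum>x\<in>Gm. R (x, v \<otimes> y)) = (\<Sum>x\<in>Gm. of_real (coef \<one> x v y))"
    by (intro sum.cong refl) (simp add: R_coef[symmetric])
  ultimately have "complex_of_real (\<Sum>x\<in>Gm. coef \<one> x v y) = of_real (if y = \<one> then 1 else 0)"
    by simp
  then show ?thesis unfolding of_real_eq_iff .
qed

lemma coef_id_eps:
  assumes "u \<in> Gp" "x \<in> Gm"
  shows "(\<Sum>y\<in>Gm. coef u x \<one> y) = (if x = \<one> then 1 else 0)"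
proof -
  have "id_eps G Gp Gm R (u \<otimes> x) = hunit Gp (u \<otimes> x)"
    using quasi by (simp add: quasi_triangular_def)
  then have "(\<Sum>y\<in>Gm. R (u \<otimes> x, y)) = (if x = \<one> then 1 else 0)"
    using assms by (simp add: id_eps_eq)
  moreover have "(\<Sum>y\<in>Gm. R (u \<otimes> x, y)) = (\<Sum>y\<in>Gm. of_real (coef u x \<one> y))"
    by (intro sum.cong refl) (simp add: R_coef[symmetric])
  ultimately have "complex_of_real (\<Sum>y\<in>Gm. coef u x \<one> y) = of_real (if x = \<one> then 1 else 0)"
    by simp
  then show ?thesis unfolding of_real_eq_iff .
qed

text \<open>Nonnegative terms cannot cancel: one positive product makes the sum in
  \<open>coef_cop_id\<close> positive, so the condition on its left side must hold and the
  coefficient there is positive.\<close>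

lemma coef_cop_id_pos:
  assumes "u1 \<in> Gp" "x1 \<in> Gm" "u2 \<in> Gp" "x2 \<in> Gm" "v \<in> Gp" "a \<in> Gm" "b \<in> Gm"
    and "coef u1 x1 v a > 0" "coef u2 x2 (rp v a) b > 0"
  shows "x1 = lp u2 x2 \<and> coef (u1 \<otimes> u2) x2 v (a \<otimes> b) > 0"
proof -
  have "(\<Sum>a'\<in>Gm. coef u1 x1 v a' * coef u2 x2 (rp v a') (inv a' \<otimes> (a \<otimes> b))) > 0"
    using assms by (intro sum_pos2[of _ a]) simp_all
  then show ?thesis
    using coef_cop_id[of u1 x1 u2 x2 v "a \<otimes> b"] assms by (auto split: if_splits)
qed

lemma coef_id_cop_pos:
  assumes "u \<in> Gp" "a \<in> Gm" "b \<in> Gm" "u2 \<in> Gp" "x2 \<in> Gm" "u3 \<in> Gp" "x3 \<in> Gm"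
    and "coef u a u3 x3 > 0" "coef (rp u a) b u2 x2 > 0"
  shows "x2 = lp u3 x3 \<and> coef u (a \<otimes> b) (u2 \<otimes> u3) x3 > 0"
proof -
  have "(\<Sum>a'\<in>Gm. coef u a' u3 x3 * coef (rp u a') (inv a' \<otimes> (a \<otimes> b)) u2 x2) > 0"
    using assms by (intro sum_pos2[of _ a]) simp_all
  then show ?thesis
    using coef_id_cop[of u "a \<otimes> b" u2 x2 u3 x3] assms by (auto split: if_splits)
qed

lemma coef_one_left: "\<lbrakk>x \<in> Gm; v \<in> Gp; y \<in> Gm; coef \<one> x v y > 0\<rbrakk> \<Longrightarrow> y = \<one>"
  using coef_eps_id[of v y] sum_pos2[of Gm x "\<lambda>x. coef \<one> x v y"] by (auto split: if_splits)

lemma coef_one_right: "\<lbrakk>u \<in> Gp; x \<in> Gm; y \<in> Gm; coef u x \<one> y > 0\<rbrakk> \<Longrightarrow> x = \<one>"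
  using coef_id_eps[of u x] sum_pos2[of Gm y "\<lambda>y. coef u x \<one> y"] by (auto split: if_splits)

text \<open>Otherwise every term of the product of \<open>R\<close> with its inverse vanishes at the
  identity arrow over \<open>(u, v)\<close>, where the unit takes the value 1.\<close>

lemma coef_exists:
  assumes "u \<in> Gp" "v \<in> Gp"
  shows "\<exists>x\<in>Gm. \<exists>y\<in>Gm. coef u x v y > 0"
proof (rule ccontr)
  assume "\<not> ?thesis"
  then have "coef u x v y = 0" if "x \<in> Gm" "y \<in> Gm" for x y
    using that coef_nonneg[of u x v y] by (auto simp: not_less intro: antisym)
  then have 0: "R (u \<otimes> x, v \<otimes> y) = 0" if "x \<in> Gm" "y \<in> Gm" for x y
    using that by (simp add: R_coef)
  obtain R' where "tmult2 G Gp Gm R R' = tunit2 Gp"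
    using quasi by (auto simp: quasi_triangular_def)
  then have "tmult2 G Gp Gm R R' (u \<otimes> \<one>, v \<otimes> \<one>) = tunit2 Gp (u \<otimes> \<one>, v \<otimes> \<one>)" by simp
  then show False
    unfolding tmult2_eq[OF assms(1) Gm_closed(3) assms(2) Gm_closed(3)]
    using assms by (simp add: 0 tunit2_def hunit_def)
qed

text \<open>For fixed \<open>u\<close>, the support of \<open>coef u\<close> injects into \<open>Gp\<close> by the target \<open>rp v y\<close> and maps
  onto \<open>Gp\<close> by the source \<open>v\<close>, so by counting the source determines the element.\<close>

lemma coef_unique:
  assumes "u \<in> Gp" "v \<in> Gp" "x \<in> Gm" "y \<in> Gm" "x' \<in> Gm" "y' \<in> Gm"
    and "coef u x v y > 0" "coef u x' v y' > 0"
  shows "x = x' \<and> y = y'"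
proof -
  define S where "S = {(x, v, y). x \<in> Gm \<and> v \<in> Gp \<and> y \<in> Gm \<and> coef u x v y > 0}"
  define src tgt where "src = (\<lambda>(x :: 'a, v :: 'a, y :: 'a). v)" and "tgt = (\<lambda>(x :: 'a, v, y). rp v y)"
  have "S \<subseteq> Gm \<times> Gp \<times> Gm" by (auto simp: S_def)
  then have fin: "finite S" by (rule finite_subset) simp
  have tgt_inj: "inj_on tgt S"
  proof (rule inj_onI)
    fix p q assume "p \<in> S" "q \<in> S" "tgt p = tgt q"
    then obtain x v y x' v' y' where pq: "p = (x, v, y)" "q = (x', v', y')"
      and in_S: "(x, v, y) \<in> S" "(x', v', y') \<in> S" and eq: "tgt (x, v, y) = tgt (x', v', y')"
      by (metis prod_cases3)
    let ?w = "rp v y"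
    have w: "rp v' y' = ?w" using eq by (simp add: tgt_def)
    have m: "x \<in> Gm" "v \<in> Gp" "y \<in> Gm" "coef u x v y > 0" "x' \<in> Gm" "v' \<in> Gp" "y' \<in> Gm" "coef u x' v' y' > 0"
      using in_S by (auto simp: S_def)
    \<comment> \<open>Both elements are composed with one arrow over \<open>inv u\<close> that
      starts at their common target. The composites lie over \<open>\<one>\<close>, where the counit
      axiom forces a trivial second label; hence \<open>y\<close> and \<open>y'\<close> are both
      inverse to \<open>b\<close>.\<close>
    obtain x2 b where b: "x2 \<in> Gm" "b \<in> Gm" "coef (inv u) x2 ?w b > 0"
      using coef_exists[of "inv u" ?w] assms(1) m by auto
    have 1: "x = lp (inv u) x2" "coef \<one> x2 v (y \<otimes> b) > 0"
      using coef_cop_id_pos[of u x "inv u" x2 v y b] assms(1) m b by simp_all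
    have 2: "x' = lp (inv u) x2" "coef \<one> x2 v' (y' \<otimes> b) > 0"
      using coef_cop_id_pos[of u x' "inv u" x2 v' y' b] assms(1) m b w by simp_all
    have "y \<otimes> b = \<one>" "y' \<otimes> b = \<one>"
      using coef_one_left[of x2 v "y \<otimes> b"] coef_one_left[of x2 v' "y' \<otimes> b"] 1 2 m b by simp_all
    then have y: "y = y'" using m b r_cancel[of y b y'] by simp
    have "v = v'"
      using inj_onD[OF bij_betw_imp_inj_on[OF bij_rp[OF m(3)]], of v v'] w y m by simp
    with 1 2 y show "p = q" by (simp add: pq)
  qed
  have "tgt ` S \<subseteq> Gp" by (auto simp: S_def tgt_def)
  then have "card S \<le> card Gp" using card_inj_on_le[OF tgt_inj] by simp
  moreover have "src ` S = Gp"
  proof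
    show "Gp \<subseteq> src ` S"
    proof
      fix v assume "v \<in> Gp"
      then obtain x y where "(x, v, y) \<in> S" using coef_exists[OF assms(1)] unfolding S_def by blast
      then show "v \<in> src ` S" by (rule rev_image_eqI) (simp add: src_def)
    qed
  qed (auto simp: S_def src_def)
  ultimately have "card (src ` S) = card S"
    using card_image_le[OF fin, of src] by simp
  then have "inj_on src S" by (rule eq_card_imp_inj_on[OF fin])
  from inj_onD[OF this, of "(x, v, y)" "(x', v, y')"] assms show ?thesis
    by (simp add: S_def src_def)
qed

section \<open>The labels of the support and the homomorphisms they define\<close>

definition parts :: "'a \<Rightarrow> 'a \<Rightarrow> 'a \<times> 'a" where
  "parts u v = (SOME p. fst p \<in> Gm \<and> snd p \<in> Gm \<and> coef u (fst p) v (snd p) > 0)"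
definition xpart :: "'a \<Rightarrow> 'a \<Rightarrow> 'a" where "xpart u v = fst (parts u v)"
definition ypart :: "'a \<Rightarrow> 'a \<Rightarrow> 'a" where "ypart u v = snd (parts u v)"
definition weight where "weight u v = coef u (xpart u v) v (ypart u v)"

lemma parts_props:
  assumes "u \<in> Gp" "v \<in> Gp"
  shows xpart_closed [simp]: "xpart u v \<in> Gm" and ypart_closed [simp]: "ypart u v \<in> Gm" and weight_pos [simp]: "weight u v > 0"
proof -
  obtain x y where "x \<in> Gm" "y \<in> Gm" "coef u x v y > 0" using coef_exists[OF assms] by blast
  then have "fst (x, y) \<in> Gm \<and> snd (x, y) \<in> Gm \<and> coef u (fst (x, y)) v (snd (x, y)) > 0" by simp
  from someI[of "\<lambda>p. fst p \<in> Gm \<and> snd p \<in> Gm \<and> coef u (fst p) v (snd p) > 0", OF this]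
  show "xpart u v \<in> Gm" "ypart u v \<in> Gm" "weight u v > 0" by (simp_all add: xpart_def ypart_def weight_def parts_def)
qed

text \<open>By \<open>coef_unique\<close> the choice made in \<open>parts\<close> is the only
  possible one.\<close>

lemma coef_pos_imp:
  assumes "u \<in> Gp" "x \<in> Gm" "v \<in> Gp" "y \<in> Gm" "coef u x v y > 0"
  shows "xpart u v = x" "ypart u v = y"
  using coef_unique[of u v "xpart u v" "ypart u v" x y] assms weight_pos[of u v] by (simp_all add: weight_def)

lemma coef_eq:
  assumes "u \<in> Gp" "x \<in> Gm" "v \<in> Gp" "y \<in> Gm"
  shows "coef u x v y = (if x = xpart u v then if y = ypart u v then weight u v else 0 else 0)"
proof (cases "coef u x v y > 0")
  case True
  then show ?thesis using coef_pos_imp[OF assms] by (simp add: weight_def)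
next
  case False
  then have 0: "coef u x v y = 0" using coef_nonneg[of u x v y] by linarith
  moreover have "\<not> (x = xpart u v \<and> y = ypart u v)"
    using 0 weight_pos[OF assms(1,3)] by (auto simp: weight_def)
  ultimately show ?thesis by auto
qed

text \<open>Composing chosen arrows yields an arrow of positive coefficient over
  \<open>(u1 \<otimes> u2, v)\<close>, which by uniqueness is the chosen one there. The axiom thus
  becomes equations between labels.\<close>

lemma parts_cop_id:
  assumes "u1 \<in> Gp" "u2 \<in> Gp" "v \<in> Gp"
  defines "w \<equiv> rp v (ypart u1 v)"
  shows "xpart u1 v = lp u2 (xpart u2 w)" "xpart (u1 \<otimes> u2) v = xpart u2 w" "ypart (u1 \<otimes> u2) v = ypart u1 v \<otimes> ypart u2 w"
proof -
  have w: "w \<in> Gp" using assms by (simp add: w_def)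
  have *: "xpart u1 v = lp u2 (xpart u2 w) \<and> coef (u1 \<otimes> u2) (xpart u2 w) v (ypart u1 v \<otimes> ypart u2 w) > 0"
    using assms w weight_pos[of u1 v] weight_pos[of u2 w] by (intro coef_cop_id_pos) (simp_all add: weight_def w_def)
  then show "xpart u1 v = lp u2 (xpart u2 w)" by simp
  show "xpart (u1 \<otimes> u2) v = xpart u2 w" "ypart (u1 \<otimes> u2) v = ypart u1 v \<otimes> ypart u2 w"
    using coef_pos_imp[of "u1 \<otimes> u2" "xpart u2 w" v "ypart u1 v \<otimes> ypart u2 w"] * assms w by simp_all
qed

lemma parts_id_cop:
  assumes "u \<in> Gp" "v2 \<in> Gp" "v3 \<in> Gp"
  defines "w \<equiv> rp u (xpart u v3)"
  shows "ypart w v2 = lp v3 (ypart u v3)" "xpart u (v2 \<otimes> v3) = xpart u v3 \<otimes> xpart w v2" "ypart u (v2 \<otimes> v3) = ypart u v3"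
proof -
  have w: "w \<in> Gp" using assms by (simp add: w_def)
  have *: "ypart w v2 = lp v3 (ypart u v3) \<and> coef u (xpart u v3 \<otimes> xpart w v2) (v2 \<otimes> v3) (ypart u v3) > 0"
    using assms w weight_pos[of u v3] weight_pos[of w v2] by (intro coef_id_cop_pos) (simp_all add: weight_def w_def)
  then show "ypart w v2 = lp v3 (ypart u v3)" by simp
  show "xpart u (v2 \<otimes> v3) = xpart u v3 \<otimes> xpart w v2" "ypart u (v2 \<otimes> v3) = ypart u v3"
    using coef_pos_imp[of u "xpart u v3 \<otimes> xpart w v2" "v2 \<otimes> v3" "ypart u v3"] * assms w by simp_all
qed

lemma ypart_one_left [simp]: "v \<in> Gp \<Longrightarrow> ypart \<one> v = \<one>"
  using coef_one_left[of "xpart \<one> v" v "ypart \<one> v"] weight_pos[of \<one> v] by (simp add: weight_def)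

lemma xpart_one_right [simp]: "u \<in> Gp \<Longrightarrow> xpart u \<one> = \<one>"
  using coef_one_right[of u "xpart u \<one>" "ypart u \<one>"] weight_pos[of u \<one>] by (simp add: weight_def)

text \<open>Labels at sources with one trivial coordinate. The inverse in \<open>\<eta>\<close>
  undoes the one in the first leg of \<open>R_xe\<close>, where
  \<open>rm x \<one> = x\<close>.\<close>

definition \<xi> where "\<xi> u = ypart u \<one>"
definition \<eta> where "\<eta> v = inv (xpart \<one> v)"

lemma xi_eta_closed [simp]: "u \<in> Gp \<Longrightarrow> \<xi> u \<in> Gm" "v \<in> Gp \<Longrightarrow> \<eta> v \<in> Gm"
  by (simp_all add: \<xi>_def \<eta>_def)

lemma ypart_eq: "u \<in> Gp \<Longrightarrow> v \<in> Gp \<Longrightarrow> ypart u v = \<xi> u"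
  using parts_id_cop(3)[of u v \<one>] by (simp add: \<xi>_def)

text \<open>For \<open>u1 = \<one>\<close> the second coordinate of the source is not moved, so
  \<open>parts_cop_id\<close> expresses \<open>xpart \<one> v\<close> through
  \<open>xpart u v\<close>; injectivity of \<open>lp u\<close> finishes.\<close>

lemma xpart_eq:
  assumes "u \<in> Gp" "v \<in> Gp" shows "xpart u v = inv (rm (\<eta> v) u)"
proof (rule inj_lp[OF assms(1)])
  have "lp u (xpart u v) = xpart \<one> v" using parts_cop_id(1)[of \<one> u v] assms by simp
  also have "\<dots> = inv (\<eta> v)" using assms by (simp add: \<eta>_def)
  finally show "lp u (xpart u v) = lp u (inv (rm (\<eta> v) u))" using assms by (simp add: mp_to_pm)
qed (use assms in simp_all)

sublocale hom_pair G Gp Gm \<xi> \<eta>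
proof
  show "\<xi> \<in> hom (G\<lparr>carrier := Gp\<rparr>) (G\<lparr>carrier := Gm\<rparr>)"
  proof (rule homI)
    fix u v assume "u \<in> carrier (G\<lparr>carrier := Gp\<rparr>)" "v \<in> carrier (G\<lparr>carrier := Gp\<rparr>)"
    then have *: "u \<in> Gp" "v \<in> Gp" by simp_all
    \<comment> \<open>\<open>\<one>\<close> is fixed by the action, so the cocycle rule loses its
      twist and becomes multiplicativity.\<close>
    have "rp \<one> (ypart u \<one>) = \<one>" using * by simp
    then show "\<xi> (u \<otimes>\<^bsub>G\<lparr>carrier := Gp\<rparr>\<^esub> v) = \<xi> u \<otimes>\<^bsub>G\<lparr>carrier := Gm\<rparr>\<^esub> \<xi> v"
      using parts_cop_id(3)[of u v \<one>] * by (simp add: \<xi>_def)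
  qed simp
  show "\<eta> \<in> hom (G\<lparr>carrier := Gp\<rparr>) (G\<lparr>carrier := Gm\<rparr>)"
  proof (rule homI)
    fix u v assume "u \<in> carrier (G\<lparr>carrier := Gp\<rparr>)" "v \<in> carrier (G\<lparr>carrier := Gp\<rparr>)"
    then have *: "u \<in> Gp" "v \<in> Gp" by simp_all
    \<comment> \<open>Again \<open>\<one>\<close> is fixed; the inverse in \<open>\<eta>\<close>
      restores the order of the factors.\<close>
    then show "\<eta> (u \<otimes>\<^bsub>G\<lparr>carrier := Gp\<rparr>\<^esub> v) = \<eta> u \<otimes>\<^bsub>G\<lparr>carrier := Gm\<rparr>\<^esub> \<eta> v"
      using parts_id_cop(2)[of \<one> u v] by (simp add: \<eta>_def inv_mult_group)
  qed simp
qed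

text \<open>The coproduct axiom with second factor \<open>\<one>\<close> equates the first labels
  over \<open>(u, v)\<close> and over \<open>(\<one>, rp v (\<xi> u))\<close>.\<close>

lemma eta_exchange: "u \<in> Gp \<Longrightarrow> v \<in> Gp \<Longrightarrow> rm (\<eta> v) u = \<eta> (rp v (\<xi> u))"
  using parts_cop_id(2)[of u \<one> v] by (simp add: ypart_eq xpart_eq inv_inj[THEN inj_on_eq_iff])

section \<open>Triviality of the coefficients\<close>

lemma weight_cop_id:
  assumes "u1 \<in> Gp" "u2 \<in> Gp" "v \<in> Gp"
  shows "weight (u1 \<otimes> u2) v = weight u1 v * weight u2 (rp v (\<xi> u1))"
proof -
  let ?w = "rp v (\<xi> u1)"
  have w: "?w \<in> Gp" using assms by simp
  have "(\<Sum>a\<in>Gm. coef u1 (xpart u1 v) v a * coef u2 (xpart u2 ?w) (rp v a) (inv a \<otimes> ypart (u1 \<otimes> u2) v))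
      = (\<Sum>a\<in>Gm. if a = \<xi> u1 then weight u1 v * weight u2 ?w else 0)"
    using assms w by (intro sum.cong refl) (simp add: coef_eq ypart_eq xi_mult)
  also have "\<dots> = weight u1 v * weight u2 ?w" using assms by simp
  finally show ?thesis
    using coef_cop_id[of u1 "xpart u1 v" u2 "xpart u2 ?w" v "ypart (u1 \<otimes> u2) v"] parts_cop_id[of u1 u2 v] assms w
    by (simp add: ypart_eq weight_def)
qed

lemma weight_id_cop:
  assumes "u \<in> Gp" "v2 \<in> Gp" "v3 \<in> Gp"
  shows "weight u (v2 \<otimes> v3) = weight u v3 * weight (lm (\<eta> v3) u) v2"
proof -
  let ?w = "lm (\<eta> v3) u"
  have w: "?w \<in> Gp" "rp u (xpart u v3) = ?w" using assms by (simp_all add: xpart_eq mp_to_pm)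
  have "(\<Sum>a\<in>Gm. coef u a v3 (ypart u v3) * coef (rp u a) (inv a \<otimes> xpart u (v2 \<otimes> v3)) v2 (ypart ?w v2))
      = (\<Sum>a\<in>Gm. if a = xpart u v3 then weight u v3 * weight ?w v2 else 0)"
    using assms w parts_id_cop(2)[of u v2 v3] by (intro sum.cong refl) (simp add: coef_eq)
  also have "\<dots> = weight u v3 * weight ?w v2" using assms by simp
  finally show ?thesis
    using coef_id_cop[of u "xpart u (v2 \<otimes> v3)" v2 "ypart ?w v2" v3 "ypart u v3"] parts_id_cop[of u v2 v3] assms w
    by (simp add: weight_def)
qed

text \<open>The products \<open>P v = (\<Prod>u. weight u v)\<close> form a homomorphism from a finite group to the positive
  reals, hence are trivial; then \<open>weight_cop_id\<close> says that \<open>weight u v\<close> is a root of unity.\<close>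

lemma weight_eq_1:
  assumes "u \<in> Gp" "v \<in> Gp"
  shows "weight u v = 1"
proof -
  define P where "P v = (\<Prod>u\<in>Gp. weight u v)" for v
  have P_pos: "P v > 0" if "v \<in> Gp" for v
    using that unfolding P_def by (intro prod_pos) simp
  have P_mult: "P (v2 \<otimes> v3) = P v3 * P v2" if "v2 \<in> Gp" "v3 \<in> Gp" for v2 v3
  proof -
    have "P (v2 \<otimes> v3) = P v3 * (\<Prod>u\<in>Gp. weight (lm (\<eta> v3) u) v2)"
      using that by (simp add: P_def weight_id_cop prod.distrib)
    also have "(\<Prod>u\<in>Gp. weight (lm (\<eta> v3) u) v2) = P v2"
      using prod.reindex_bij_betw[OF bij_lm[of "\<eta> v3"], of "\<lambda>u. weight u v2"] that by (simp add: P_def)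
    finally show ?thesis .
  qed
  have P_one: "P \<one> = 1" using P_mult[of \<one> \<one>] P_pos[of \<one>] by simp
  \<comment> \<open>Multiplying the maximal value of \<open>P\<close> by \<open>P v\<close> gives
    another value of \<open>P\<close>, so \<open>P v\<close> cannot exceed 1.\<close>
  have P_le: "P v \<le> 1" if v: "v \<in> Gp" for v
  proof -
    have "finite (P ` Gp)" "P ` Gp \<noteq> {}" using Gp_closed(3) by auto
    from Max_in[OF this] obtain v0 where v0: "v0 \<in> Gp" "Max (P ` Gp) = P v0" by auto
    have "P (v0 \<otimes> v) \<le> P v0" using Max_ge[of "P ` Gp" "P (v0 \<otimes> v)"] v v0 by simp
    then show ?thesis using P_mult[of v0 v] P_pos[of v0] v v0 by simp
  qed
  have P_1: "P v = 1" if v: "v \<in> Gp" for v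
  proof -
    have "1 = P v * P (inv v)" using P_mult[of "inv v" v] P_one v by simp
    also have "\<dots> \<le> P v" using P_le[of "inv v"] P_pos[of v] v by (simp add: mult_left_le)
    finally show ?thesis using P_le[OF v] by simp
  qed
  \<comment> \<open>Translating the index by \<open>u\<close> allows \<open>weight u v\<close> to be
    split off from every factor; what is left is a value of \<open>P\<close>, equal to 1.\<close>
  have "P v = (\<Prod>w\<in>Gp. weight (u \<otimes> w) v)"
  proof -
    have "bij_betw (\<lambda>w. u \<otimes> w) Gp Gp"
      by (rule bij_betw_byWitness[where f' = "\<lambda>w. inv u \<otimes> w"]) (use assms in auto)
    from prod.reindex_bij_betw[OF this, of "\<lambda>w. weight w v"] show ?thesis by (simp add: P_def)
  qed
  also have "\<dots> = weight u v ^ card Gp * P (rp v (\<xi> u))"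
    using assms by (simp add: weight_cop_id prod.distrib P_def)
  finally have "weight u v ^ card Gp = 1" using P_1 assms by simp
  moreover have "card Gp > 0" using Gp_closed(3) by (auto simp: card_gt_0_iff)
  ultimately show ?thesis using weight_pos[OF assms] by (intro power_eq_imp_eq_base[of "weight u v" "card Gp" 1]) simp_all
qed

lemma R_eq_R_xe: "R = R_xe G Gp Gm \<xi> \<eta>"
proof (rule ext, clarify)
  fix k1 k2
  show "R (k1, k2) = R_xe G Gp Gm \<xi> \<eta> (k1, k2)"
  proof (cases "k1 \<in> carrier G \<and> k2 \<in> carrier G")
    case False
    then show ?thesis using quasi by (auto simp: quasi_triangular_def in_H2_def R_xe_outside)
  next
    case True
    then obtain u x v y where "u \<in> Gp" "x \<in> Gm" "k1 = u \<otimes> x" "v \<in> Gp" "y \<in> Gm" "k2 = v \<otimes> y"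
      by (meson factor_obtain)
    then show ?thesis by (simp add: R_coef coef_eq weight_eq_1 xpart_eq ypart_eq R_xe_eq)
  qed
qed

text \<open>The other axioms gave the shape of \<open>R\<close>; the intertwining relation now gives
  the compatibility conditions.\<close>

lemma admissible: "admissible_pair G Gp Gm \<xi> \<eta>"
  using quasi_triangular_R_xe_imp[OF eta_exchange] quasi R_eq_R_xe admissible_pairI by simp

end

theorem theorem1:
  fixes G :: "('a,'b) monoid_scheme" and Gp Gm :: "'a set"
  assumes "group G" and "finite (carrier G)" and "unique_factorization G Gp Gm"
  shows "(\<forall>xi eta. admissible_pair G Gp Gm xi eta \<longrightarrow>
            positive2 (R_xe G Gp Gm xi eta) \<and> quasi_triangular G Gp Gm (R_xe G Gp Gm xi eta)) \<and>
         (\<forall>R. positive2 R \<and> quasi_triangular G Gp Gm R \<longrightarrow>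
            (\<exists>xi eta. admissible_pair G Gp Gm xi eta \<and> R = R_xe G Gp Gm xi eta))"
proof (intro conjI allI impI; (elim conjE)?)
  interpret group G by fact
  interpret factorized_group G Gp Gm by unfold_locales fact+
  {
    fix xi eta assume adm: "admissible_pair G Gp Gm xi eta"
    then interpret hom_pair G Gp Gm xi eta
      by unfold_locales (auto simp: admissible_pair_def)
    show "quasi_triangular G Gp Gm (R_xe G Gp Gm xi eta)"
      by (intro R_xe_quasi_triangular admissible_imp adm)
    show "positive2 (R_xe G Gp Gm xi eta)"
      unfolding positive2_def R_xe_def by (auto simp: Re_sum Im_sum intro!: sum_nonneg sum.neutral)
  }
  fix R assume "positive2 R" "quasi_triangular G Gp Gm R"
  then interpret positive_R_matrix G Gp Gm R by unfold_locales
  show "\<exists>xi eta. admissible_pair G Gp Gm xi eta \<and> R = R_xe G Gp Gm xi eta"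
    using admissible R_eq_R_xe by blast
qed

end
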